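(* Suppose that $\beta\in\mathbb{N}A\cap\mathrm{int}(\mathbb{R}_{\ge0}A)$, and fix $p\in\mathbb{R}_{>0}^n$. There exists a unique $m\in\mathbb{R}_{>0}^n$ such that $Am=\beta$ and $m^{\bar a_i}=p^{\bar a_i}$ for $i=1,\ldots,n-d$. When $k\to+\infty$ (over positive integers), we have $$Z(k\beta;p)\sim\frac{\left(\prod_{i=1}^n p_i^{m_i}\right)^k}{\Gamma(km+1)}\cdot\frac{(2\pi k)^{(n-d)/2}}{\det(\bar A M^{-1}\bar A^T)^{1/2}},$$ where $M=\mathrm{diag}(m_1,\ldots,m_n)$, $\Gamma(km+1)=\prod_{i=1}^n\Gamma(km_i+1)$, and $\sim$ means that the ratio of both sides tends to $1$.
   Context: $\mathbb{N}$ denotes the non-negative integers. $A$ is a $d\times n$ matrix with non-negative integer entries and rank $d$, which is a configuration matrix, i.e. $(1,\ldots,1)^T\in\mathbb{R}^n$ lies in the image of $A^T:\mathbb{R}^d\to\mathbb{R}^n$. With $a_i$ the columns of $A$, $\mathbb{N}A=\sum_i\mathbb{N}a_i$ and $\mathbb{R}_{\ge0}A=\sum_i\mathbb{R}_{\ge0}a_i$. $\bar A$ (the Gale transform of $A$) is an $(n-d)\times n$ integer matrix whose rows $\bar a_1,\ldots,\bar a_{n-d}$ form a $\mathbb{Z}$-basis of $\mathrm{Ker}(A:\mathbb{Z}^n\to\mathbb{Z}^d)$; for $x\in\mathbb{R}_{>0}^n$, $x^{\bar a_i}=\prod_{j=1}^n x_j^{\bar a_{ij}}$. The $A$-hypergeometric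 polynomial is $Z(\beta;p)=\sum_{u\in\mathbb{N}^n,\,Au=\beta}p^u/u!$, with $p^u=\prod_i p_i^{u_i}$ and $u!=\prod_i u_i!$. *)

theory Defs
  imports
    "HOL-Analysis.Analysis"
    "Jordan_Normal_Form.DL_Rank"
    "Jordan_Normal_Form.Matrix_Kernel"
begin

unbundle no vec_syntax and no inner_syntax
hide_type (open) Finite_Cartesian_Product.vec
hide_const (open) Finite_Cartesian_Product.vec Finite_Cartesian_Product.mat
  Finite_Cartesian_Product.transpose Determinants.det Cartesian_Space.rank

text \<open>Matrices and vectors have their dimensions as term-level parameters, so that
  \<open>(n - d)\<close>-row matrices, including the case \<open>n = d\<close> with no rows, can be treated uniformly.\<close>

definition configuration_matrix :: "nat mat \<Rightarrow> bool" where
  "configuration_matrix A \<longleftrightarrow>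
     (\<exists>y \<in> carrier_vec (dim_row A).
        transpose_mat (map_mat real A) *\<^sub>v y = Matrix.vec (dim_col A) (\<lambda>_. 1))"

definition monoid_span :: "nat mat \<Rightarrow> nat vec set" where
  "monoid_span A = {A *\<^sub>v u | u. u \<in> carrier_vec (dim_col A)}"

definition cone_span :: "nat mat \<Rightarrow> real vec set" where
  "cone_span A = {map_mat real A *\<^sub>v c | c.
     c \<in> carrier_vec (dim_col A) \<and> (\<forall>i < dim_col A. 0 \<le> c $ i)}"

text \<open>The usual topology of \<open>\<real>\<^sup>d\<close>, transported to \<open>carrier_vec d\<close>; a characterization by
  boxes is proved below.\<close>

definition vec_topology :: "nat \<Rightarrow> real vec topology" where
  "vec_topology d = pullback_topology (carrier_vec d) (\<lambda>v. restrict (($) v) {..<d})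
     (product_topology (\<lambda>_. euclideanreal) {..<d})"

text \<open>The rows of \<open>B\<close> form an (ordered) basis of the lattice \<open>mat_kernel A\<close>: they lie in it, they
  are linearly independent over the integers, and they generate it. Integer combinations of the
  rows are the vectors \<open>transpose_mat B *\<^sub>v c\<close>.\<close>

definition gale_transform :: "nat mat \<Rightarrow> int mat \<Rightarrow> bool" where
  "gale_transform A B \<longleftrightarrow>
     B \<in> carrier_mat (dim_col A - dim_row A) (dim_col A) \<and>
     (\<forall>i < dim_row B. row B i \<in> mat_kernel (map_mat int A)) \<and>
     (\<forall>c \<in> carrier_vec (dim_row B).
        transpose_mat B *\<^sub>v c = 0\<^sub>v (dim_col B) \<longrightarrow> c = 0\<^sub>v (dim_row B)) \<and>
     (\<forall>x \<in> mat_kernel (map_mat int A). \<exists>c \<in> carrier_vec (dim_row B).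
        x = transpose_mat B *\<^sub>v c)"

definition fiber :: "nat mat \<Rightarrow> nat vec \<Rightarrow> nat vec set" where
  "fiber A \<beta> = {u \<in> carrier_vec (dim_col A). A *\<^sub>v u = \<beta>}"

text \<open>The index set of the sum is finite for a configuration matrix, see \<open>finite_fiber\<close> below.\<close>

definition hypergeometric_poly :: "nat mat \<Rightarrow> nat vec \<Rightarrow> real vec \<Rightarrow> real" where
  "hypergeometric_poly A \<beta> p =
     (\<Sum>u \<in> fiber A \<beta>. (\<Prod>i < dim_col A. p $ i ^ (u $ i)) / (\<Prod>i < dim_col A. fact (u $ i)))"

definition pos_vec :: "nat \<Rightarrow> real vec set" where
  "pos_vec n = {x \<in> carrier_vec n. \<forall>i < n. 0 < x $ i}"

definition int_monomial :: "real vec \<Rightarrow> int vec \<Rightarrow> real" where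
  "int_monomial x a = (\<Prod>j < dim_vec a. x $ j powi (a $ j))"

lemma finite_fiber:
  assumes "configuration_matrix A"
  shows "finite (fiber A \<beta>)"
proof -
  define n where "n = dim_col A"
  define d where "d = dim_row A"
  have AR: "map_mat real A \<in> carrier_mat d n" by (auto simp: n_def d_def)
  obtain y where y: "y \<in> carrier_vec d"
    and yA: "transpose_mat (map_mat real A) *\<^sub>v y = Matrix.vec n (\<lambda>_. 1)"
    using assms unfolding configuration_matrix_def n_def d_def by blast
  define N where "N = nat \<lceil>map_vec real \<beta> \<bullet> y\<rceil>"
  have "u \<in> vec_of_list ` {xs. set xs \<subseteq> {..N} \<and> length xs = n}" if u: "u \<in> fiber A \<beta>" for u
  proof -
    have uc: "u \<in> carrier_vec n" and Au: "A *\<^sub>v u = \<beta>" using u by (auto simp: fiber_def n_def)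
    have b: "map_vec real \<beta> = map_mat real A *\<^sub>v map_vec real u"
      using Au uc by (auto simp: n_def scalar_prod_def)
    have "map_vec real \<beta> \<bullet> y = y \<bullet> map_vec real \<beta>"
      unfolding b using AR y uc by (intro comm_scalar_prod[of _ d]) auto
    also have "\<dots> = (transpose_mat (map_mat real A) *\<^sub>v y) \<bullet> map_vec real u"
      unfolding b using AR y uc by (intro transpose_vec_mult_scalar[symmetric]) auto
    also have "\<dots> = (\<Sum>i<n. real (u $ i))"
      unfolding yA using uc by (auto simp: scalar_prod_def lessThan_atLeast0)
    finally have s: "map_vec real \<beta> \<bullet> y = (\<Sum>i<n. real (u $ i))" .
    have "u $ i \<le> N" if "i < n" for i
    proof -
      have "real (u $ i) \<le> (\<Sum>i<n. real (u $ i))"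
        using that by (intro member_le_sum) auto
      then show ?thesis unfolding N_def s by linarith
    qed
    then have "set (list_of_vec u) \<subseteq> {..N}"
      using uc by (auto simp: set_list_of_vec vec_set_def)
    moreover have "length (list_of_vec u) = n" using uc by simp
    ultimately show ?thesis by (intro image_eqI[of _ _ "list_of_vec u"]) (auto simp: vec_list)
  qed
  then have "fiber A \<beta> \<subseteq> vec_of_list ` {xs. set xs \<subseteq> {..N} \<and> length xs = n}" by blast
  then show ?thesis
    by (rule finite_subset) (intro finite_imageI finite_lists_length_eq, simp)
qed

lemma interior_of_vec_topology_iff:
  assumes x: "x \<in> carrier_vec d"
  shows "x \<in> vec_topology d interior_of S \<longleftrightarrow>
    (\<exists>e > 0. \<forall>y \<in> carrier_vec d. (\<forall>i < d. \<bar>y $ i - x $ i\<bar> < e) \<longrightarrow> y \<in> S)"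
    (is "?L \<longleftrightarrow> ?R")
proof
  let ?r = "\<lambda>v::real vec. restrict (($) v) {..<d}"
  assume ?L
  then obtain W where W: "openin (product_topology (\<lambda>_. euclideanreal) {..<d}) W"
    and xW: "?r x \<in> W" and WS: "?r -` W \<inter> carrier_vec d \<subseteq> S"
    unfolding interior_of_def vec_topology_def openin_pullback_topology by auto
  have "\<forall>z\<in>W. \<exists>U. (\<forall>i<d. open (U i)) \<and> z \<in> Pi\<^sub>E {..<d} U \<and> Pi\<^sub>E {..<d} U \<subseteq> W"
  proof
    fix z assume "z \<in> W"
    with W obtain U where "\<forall>i\<in>{..<d}. openin euclideanreal (U i)" "z \<in> Pi\<^sub>E {..<d} U"
      "Pi\<^sub>E {..<d} U \<subseteq> W"
      unfolding openin_product_topology_alt by meson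
    then show "\<exists>U. (\<forall>i<d. open (U i)) \<and> z \<in> Pi\<^sub>E {..<d} U \<and> Pi\<^sub>E {..<d} U \<subseteq> W"
      by (intro exI[of _ U]) simp
  qed
  from this[rule_format, OF xW] obtain U where U: "\<And>i. i < d \<Longrightarrow> open (U i)"
    and xU: "?r x \<in> Pi\<^sub>E {..<d} U" and UW: "Pi\<^sub>E {..<d} U \<subseteq> W"
    by blast
  have "\<exists>e>0. \<forall>t. \<bar>t - x $ i\<bar> < e \<longrightarrow> t \<in> U i" if "i < d" for i
    using U[OF that] xU that unfolding open_dist by (auto simp: dist_real_def PiE_iff)
  then obtain e where e: "\<And>i. i < d \<Longrightarrow> e i > 0"
    "\<And>i t. i < d \<Longrightarrow> \<bar>t - x $ i\<bar> < e i \<Longrightarrow> t \<in> U i" by metis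
  define e0 where "e0 = Min (insert 1 (e ` {..<d}))"
  have "e0 > 0" unfolding e0_def using e(1) by (subst Min_gr_iff) auto
  have le: "e0 \<le> e i" if "i < d" for i unfolding e0_def using that by (intro Min_le) auto
  have "y \<in> S" if y: "y \<in> carrier_vec d" "\<forall>i<d. \<bar>y $ i - x $ i\<bar> < e0" for y
  proof -
    have "y $ i \<in> U i" if "i < d" for i
      using y(2) le[OF that] that by (intro e(2)) (auto intro: less_le_trans)
    then have "?r y \<in> Pi\<^sub>E {..<d} U" by auto
    then show ?thesis using UW WS y(1) by blast
  qed
  with \<open>e0 > 0\<close> show ?R by blast
next
  let ?r = "\<lambda>v::real vec. restrict (($) v) {..<d}"
  assume ?R
  then obtain e where e: "e > 0" "\<And>y. y \<in> carrier_vec d \<Longrightarrow> (\<forall>i<d. \<bar>y $ i - x $ i\<bar> < e) \<Longrightarrow> y \<in> S"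
    by blast
  define W where "W = Pi\<^sub>E {..<d} (\<lambda>i. ball (x $ i) e)"
  have W: "openin (product_topology (\<lambda>_. euclideanreal) {..<d}) W"
    unfolding W_def by (rule openin_PiE_gen[THEN iffD2]) auto
  have "openin (vec_topology d) (?r -` W \<inter> carrier_vec d)"
    unfolding vec_topology_def openin_pullback_topology using W by blast
  moreover have "x \<in> ?r -` W \<inter> carrier_vec d" using x e(1) by (auto simp: W_def)
  moreover have "?r -` W \<inter> carrier_vec d \<subseteq> S"
    using e(2) by (auto simp: W_def PiE_iff dist_real_def abs_minus_commute)
  ultimately show ?L unfolding interior_of_def by blast
qed

end

theory Submission
  imports Defs "HOL-Probability.Distributions"
begin

text \<open>The proof is Laplace's method on the lattice of integer points of the kernel of \<open>A\<close>.
  Let \<open>r = n - d\<close>, and let \<open>m\<close> be the positive solution.  A point \<open>u\<close> of the fibre over \<open>k\<beta>\<close>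
  differs from \<open>k m\<close> by a vector \<open>g\<close> in the kernel of \<open>A\<close>.  On such vectors the monomials of \<open>p\<close>,
  of \<open>m\<close> and of \<open>k m\<close> agree: the first two by the choice of \<open>m\<close>, the last two because the
  coordinates of \<open>g\<close> add up to \<open>0\<close> for a configuration matrix.  Hence \<open>p\<^sup>u / u!\<close>, divided by
  \<open>\<Prod>\<^sub>i p\<^sub>i powr (k m\<^sub>i) / \<Gamma>(k m\<^sub>i + 1)\<close>, is the product over \<open>i\<close> of
  \<open>x powr (u\<^sub>i - x) \<Gamma>(x + 1) / \<Gamma>(u\<^sub>i + 1)\<close> with \<open>x = k m\<^sub>i\<close>, which is the ratio of the Poisson weight of mean
  \<open>x\<close> at \<open>u\<^sub>i\<close> to its value at the mean.

  Two estimates describe this ratio.  Where \<open>u\<^sub>i - x\<close> is about \<open>t \<surd>k\<close>, it tends to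
  \<open>exp (- t\<^sup>2 / (2 m\<^sub>i))\<close> (\<open>poisson_ratio_local_limit\<close>), and it decays exponentially in
  \<open>\<bar>u\<^sub>i - x\<bar> / \<surd>x\<close>, uniformly in \<open>x\<close> (\<open>poisson_ratio_tail\<close>).  Both come from
  \<open>ln s \<le> Digamma (s + 1) \<le> ln (s + 1)\<close>.

  The rows of \<open>B\<close> parametrize the fibre as \<open>u = k m + B\<^sup>T(z + k w)\<close> with \<open>z\<close> an integer vector and
  \<open>w\<close> a fixed real one.  So the normalized sum over the fibre is \<open>k powr (r/2)\<close> times the integral of a step
  function on boxes of side \<open>1/\<surd>k\<close> (\<open>has_bochner_integral_step_function\<close>), and dominated
  convergence gives the limit \<open>\<integral> exp (- s\<^sup>T B M\<^sup>-\<^sup>1 B\<^sup>T s / 2) ds\<close> (\<open>weight_sum_asymptotics\<close>).  This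
  Gaussian integral is \<open>(2\<pi>) powr (r/2) / \<surd>det (B M\<^sup>-\<^sup>1 B\<^sup>T)\<close>, by induction on \<open>r\<close>
  (\<open>gaussian_integral_quad_form\<close>).

  The point \<open>m\<close> is found as \<open>m\<^sub>i = p\<^sub>i exp ((A\<^sup>T y)\<^sub>i)\<close>: the monomial equations then hold for every
  \<open>y\<close>, and \<open>A m = \<beta>\<close> says that \<open>y\<close> is critical for a convex function that is coercive because
  \<open>\<beta>\<close> is interior to the cone (\<open>positive_solution_exists\<close>).  It is unique because \<open>ln\<close> is
  strictly increasing (\<open>positive_solution_unique\<close>).\<close>

(* This makes $ denote only the entries of vectors whose dimension is a term. *)
unbundle no vec_syntax and no inner_syntax

section \<open>Ratios of Poisson weights\<close>

text \<open>The Poisson weight of mean \<open>x\<close> at \<open>u\<close>, divided by the interpolation of these weights at \<open>x\<close>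
  itself.  Written with the reciprocal Gamma function it vanishes at negative integers, so that
  lattice points outside the nonnegative orthant contribute nothing.\<close>

definition poisson_ratio :: "real \<Rightarrow> real \<Rightarrow> real" where
  "poisson_ratio x u = x powr (u - x) * Gamma (x + 1) * rGamma (u + 1)"

definition ln_poisson_ratio :: "real \<Rightarrow> real \<Rightarrow> real" where
  "ln_poisson_ratio x u = (u - x) * ln x + ln_Gamma (x + 1) - ln_Gamma (u + 1)"

lemma poisson_ratio_eq_exp:
  assumes "0 < x" "-1 < u"
  shows "poisson_ratio x u = exp (ln_poisson_ratio x u)"
  using assms
  by (simp add: poisson_ratio_def ln_poisson_ratio_def powr_def exp_add exp_diff rGamma_inverse_Gamma
      Gamma_real_pos_exp divide_inverse)

lemma ln_poisson_ratio_refl [simp]: "ln_poisson_ratio x x = 0"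
  by (simp add: ln_poisson_ratio_def)

lemma pos_real_not_nonpos_Int: "0 < (s::real) \<Longrightarrow> s \<notin> \<int>\<^sub>\<le>\<^sub>0"
  by (auto elim!: nonpos_Ints_cases)

text \<open>The functional equation makes \<open>ln_Gamma\<close> grow by \<open>ln s\<close> on \<open>[s, s + 1]\<close>, so \<open>ln s\<close> is a value of
  the increasing function \<open>Digamma\<close> on that interval.\<close>

lemma Digamma_ln_bounds:
  fixes s :: real
  assumes "0 < s"
  shows "ln s \<le> Digamma (s + 1)" "Digamma s \<le> ln s"
proof -
  have "\<exists>z>s. z < s + 1 \<and> ln_Gamma (s + 1) - ln_Gamma s = (s + 1 - s) * Digamma z"
    using assms by (intro MVT2) (auto intro!: derivative_eq_intros)
  then obtain z where z: "s < z" "z < s + 1" "ln_Gamma (s + 1) - ln_Gamma s = Digamma z" by auto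
  have "exp (ln_Gamma (s + 1)) = exp (ln s + ln_Gamma s)"
    using assms Gamma_plus1[of s] pos_real_not_nonpos_Int[of s]
    by (simp add: Gamma_real_pos_exp[symmetric] exp_add)
  then have "ln s = Digamma z" using z(3) by simp
  with z show "ln s \<le> Digamma (s + 1)" "Digamma s \<le> ln s"
    using Digamma_real_mono[of z "s + 1"] Digamma_real_mono[of s z] assms by auto
qed

lemma DERIV_ln_poisson_ratio:
  fixes s x :: real
  assumes "0 \<le> s"
  shows "(ln_poisson_ratio x has_field_derivative ln x - Digamma (s + 1)) (at s)"
  unfolding ln_poisson_ratio_def[abs_def]
  using assms by (auto intro!: derivative_eq_intros)

text \<open>The slope \<open>ln x - Digamma (s + 1)\<close> lies between \<open>ln (x / (s + 1))\<close> and \<open>ln (x / s)\<close>; the rational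
  bounds follow from \<open>ln t \<le> t - 1\<close>.\<close>

lemma slope_ln_poisson_ratio_le:
  fixes s x :: real
  assumes "0 < x" "0 < s"
  shows "ln x - Digamma (s + 1) \<le> x / s - 1"
  using Digamma_ln_bounds(1)[of s] ln_le_minus_one[of "x / s"] assms by (simp add: ln_div)

lemma slope_ln_poisson_ratio_ge:
  fixes s x :: real
  assumes "0 < x" "0 \<le> s"
  shows "1 - (s + 1) / x \<le> ln x - Digamma (s + 1)"
  using Digamma_ln_bounds(2)[of "s + 1"] ln_le_minus_one[of "(s + 1) / x"] assms
  by (simp add: ln_div)

lemma ln_poisson_ratio_MVT:
  assumes "0 \<le> a" "a < b"
  obtains z where "a < z" "z < b"
    "ln_poisson_ratio x b - ln_poisson_ratio x a = (b - a) * (ln x - Digamma (z + 1))"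
  using MVT2[of a b "ln_poisson_ratio x" "\<lambda>s. ln x - Digamma (s + 1)"] assms
    DERIV_ln_poisson_ratio by (metis order_trans)

text \<open>To the right of \<open>x\<close> the function decreases, and from \<open>x + sqrt x\<close> on with slope at most
  \<open>- 1 / (sqrt x + 1)\<close>.\<close>

lemma ln_poisson_ratio_upper_tail:
  assumes "0 < x" "x \<le> u"
  shows "ln_poisson_ratio x u \<le> 1 - (u - x) / (sqrt x + 1)"
proof -
  have neg: "ln_poisson_ratio x v \<le> 0" if "x \<le> v" for v
  proof (cases "x = v")
    case False
    with that assms have xv: "0 \<le> x" "x < v" by auto
    obtain z where z: "x < z" "z < v"
      "ln_poisson_ratio x v - ln_poisson_ratio x x = (v - x) * (ln x - Digamma (z + 1))"
      using ln_poisson_ratio_MVT[OF xv, of x] by blast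
    have "x / z - 1 \<le> 0" using z(1) assms by simp
    then have "ln x - Digamma (z + 1) \<le> 0"
      using slope_ln_poisson_ratio_le[of x z] z(1) assms by linarith
    with z(3) False that show ?thesis by (simp add: mult_nonneg_nonpos)
  qed simp
  let ?v = "x + sqrt x"
  show ?thesis
  proof (cases "u \<le> ?v")
    case True
    then have "(u - x) / (sqrt x + 1) \<le> 1" using assms by (simp add: divide_simps)
    with neg[OF assms(2)] show ?thesis by linarith
  next
    case False
    then obtain z where z: "?v < z" "z < u"
      "ln_poisson_ratio x u - ln_poisson_ratio x ?v = (u - ?v) * (ln x - Digamma (z + 1))"
      using ln_poisson_ratio_MVT[of ?v u x] assms by auto
    have "0 < ?v" using assms by (intro add_pos_pos) auto
    have "ln x - Digamma (z + 1) \<le> x / z - 1"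
      using slope_ln_poisson_ratio_le[of x z] z(1) \<open>0 < ?v\<close> assms by simp
    also have "\<dots> \<le> x / ?v - 1"
      using z(1) \<open>0 < ?v\<close> assms by (simp add: frac_le)
    also have "\<dots> = - 1 / (sqrt x + 1)"
    proof -
      have "?v = sqrt x * (sqrt x + 1)" using assms by (simp add: algebra_simps)
      moreover have "x = sqrt x * sqrt x" using assms by simp
      ultimately have "x / ?v = sqrt x / (sqrt x + 1)"
        using assms by (metis less_irrefl mult_divide_mult_cancel_left real_sqrt_gt_0_iff)
      moreover have "sqrt x + 1 > 0" using assms by (simp add: add_pos_pos)
      ultimately show ?thesis by (simp add: field_simps)
    qed
    finally have "(u - ?v) * (ln x - Digamma (z + 1)) \<le> (u - ?v) * (- 1 / (sqrt x + 1))"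
      using False by (intro mult_left_mono) auto
    moreover have "(u - ?v) * (- 1 / (sqrt x + 1)) = sqrt x / (sqrt x + 1) - (u - x) / (sqrt x + 1)"
      by (simp add: diff_divide_distrib add_divide_distrib)
    moreover have "sqrt x / (sqrt x + 1) \<le> 1"
      using assms by (intro divide_le_eq_1[THEN iffD2]) (auto intro: add_pos_pos)
    moreover have "ln_poisson_ratio x ?v \<le> 0" using assms by (intro neg) simp
    ultimately show ?thesis using z(3) by linarith
  qed
qed

text \<open>To the left of \<open>x\<close> the slope is at least \<open>- 1 / x\<close>, so the function never exceeds \<open>1\<close>.  To the left
  of \<open>x - sqrt x\<close> the slope is at least \<open>1 / sqrt x - 1 / x\<close>.\<close>

lemma ln_poisson_ratio_lower_tail:
  assumes "0 < x" "0 \<le> u" "u \<le> x"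
  shows "ln_poisson_ratio x u \<le> 3 - (x - u) / sqrt x"
proof -
  have le1: "ln_poisson_ratio x v \<le> 1" if "0 \<le> v" "v \<le> x" for v
  proof (cases "x = v")
    case False
    with that have xv: "0 \<le> v" "v < x" by auto
    obtain z where z: "v < z" "z < x"
      "ln_poisson_ratio x x - ln_poisson_ratio x v = (x - v) * (ln x - Digamma (z + 1))"
      using ln_poisson_ratio_MVT[OF xv, of x] by blast
    have "- 1 / x \<le> 1 - (z + 1) / x" using z assms by (simp add: field_simps)
    also have "\<dots> \<le> ln x - Digamma (z + 1)"
      using slope_ln_poisson_ratio_ge[of x z] z that assms by simp
    finally have "(x - v) * (- 1 / x) \<le> (x - v) * (ln x - Digamma (z + 1))"
      using that by (intro mult_left_mono) auto
    moreover have "(x - v) / x \<le> 1" using that assms by (simp add: divide_simps)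
    ultimately show ?thesis using z(3) by auto
  qed simp
  let ?v = "x - sqrt x"
  have s: "0 < sqrt x" using assms by simp
  show ?thesis
  proof (cases "?v \<le> u")
    case True
    then have "(x - u) / sqrt x \<le> 1" using s by (simp add: divide_simps)
    with le1[OF assms(2,3)] show ?thesis by linarith
  next
    case False
    then obtain z where z: "u < z" "z < ?v"
      "ln_poisson_ratio x ?v - ln_poisson_ratio x u = (?v - u) * (ln x - Digamma (z + 1))"
      using ln_poisson_ratio_MVT[of u ?v x] assms by auto
    have "1 / sqrt x - 1 / x = 1 - (?v + 1) / x"
      using assms sqrt_divide_self_eq[of x]
      by (simp add: diff_divide_distrib add_divide_distrib inverse_eq_divide)
    also have "\<dots> \<le> 1 - (z + 1) / x" using z assms by (simp add: divide_right_mono)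
    also have "\<dots> \<le> ln x - Digamma (z + 1)"
      using slope_ln_poisson_ratio_ge[of x z] z assms by simp
    finally have "(?v - u) * (1 / sqrt x - 1 / x) \<le> (?v - u) * (ln x - Digamma (z + 1))"
      using False by (intro mult_left_mono) auto
    moreover have "?v - u \<le> x" using assms s by linarith
    then have "(?v - u) / x \<le> 1" using assms by (simp add: divide_le_eq)
    moreover have "(?v - u) * (1 / sqrt x - 1 / x) = (?v - u) / sqrt x - (?v - u) / x"
      by (simp add: right_diff_distrib)
    moreover have "ln_poisson_ratio x ?v \<le> 1" using assms False s by (intro le1) linarith+
    moreover have "(?v - u) / sqrt x = (x - u) / sqrt x - 1" using s by (simp add: field_simps)
    ultimately show ?thesis using z(3) by linarith
  qed
qed

text \<open>The decay on the scale \<open>sqrt x\<close> is uniform in \<open>x\<close>.  This yields the integrable majorant for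
  dominated convergence.\<close>

lemma poisson_ratio_tail:
  assumes "0 < x" "0 \<le> u"
  shows "poisson_ratio x u \<le> exp (3 - \<bar>u - x\<bar> / (sqrt x + 1))"
proof -
  have "ln_poisson_ratio x u \<le> 3 - \<bar>u - x\<bar> / (sqrt x + 1)"
  proof (cases "x \<le> u")
    case True
    then show ?thesis using ln_poisson_ratio_upper_tail[OF assms(1) True] by simp
  next
    case False
    have "(x - u) / (sqrt x + 1) \<le> (x - u) / sqrt x"
      using assms False by (intro divide_left_mono) (auto intro!: mult_pos_pos add_pos_pos)
    then show ?thesis using ln_poisson_ratio_lower_tail[of x u] assms False by simp
  qed
  then show ?thesis using assms by (simp add: poisson_ratio_eq_exp)
qed

text \<open>The quantity to be bounded vanishes at \<open>u = x\<close>, and its derivative at \<open>s\<close> lies between \<open>- 1 / x\<close> and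
  \<open>x / s - 1 + (s - x) / x = (s - x)\<^sup>2 / (x s)\<close>.\<close>

lemma ln_poisson_ratio_quadratic:
  assumes "0 < x" "0 < u"
  shows "\<bar>ln_poisson_ratio x u + (u - x)\<^sup>2 / (2 * x)\<bar> \<le> \<bar>u - x\<bar> * (1 / x + (u - x)\<^sup>2 / (x * min x u))"
proof -
  define E where "E = (\<lambda>s. ln_poisson_ratio x s + (s - x)\<^sup>2 / (2 * x))"
  define E' where "E' = (\<lambda>s. ln x - Digamma (s + 1) + (s - x) / x)"
  let ?K = "1 / x + (u - x)\<^sup>2 / (x * min x u)"
  have D: "(E has_field_derivative E' s) (at s)" if "0 \<le> s" for s
    unfolding E_def E'_def using assms
    by (auto intro!: derivative_eq_intros DERIV_ln_poisson_ratio[OF that] simp: field_simps)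
  have bd: "\<bar>E' s\<bar> \<le> ?K" if s: "min x u \<le> s" "s \<le> max x u" for s
  proof -
    have s0: "0 < s" using s assms by auto
    have sq: "(s - x)\<^sup>2 \<le> (u - x)\<^sup>2"
      using s by (intro abs_le_square_iff[THEN iffD1]) auto
    have pos: "0 < x * min x u" using assms by auto
    have "E' s \<le> (x / s - 1) + (s - x) / x"
      using slope_ln_poisson_ratio_le[of x s] s0 assms by (simp add: E'_def)
    also have "\<dots> = (s - x)\<^sup>2 / (x * s)"
      using s0 assms by (simp add: field_simps power2_eq_square)
    also have "\<dots> \<le> (u - x)\<^sup>2 / (x * min x u)"
      using sq s assms pos by (intro frac_le) auto
    also have "\<dots> \<le> ?K" using assms by simp
    finally have 1: "E' s \<le> ?K" .
    have "- (1 / x) \<le> E' s"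
      using slope_ln_poisson_ratio_ge[of x s] s0 assms by (simp add: E'_def field_simps)
    moreover have "0 \<le> (u - x)\<^sup>2 / (x * min x u)" using pos by simp
    ultimately show ?thesis using 1 by linarith
  qed
  have Ex: "E x = 0" by (simp add: E_def)
  have "\<bar>E u - E x\<bar> \<le> \<bar>u - x\<bar> * ?K"
  proof (cases u x rule: linorder_cases)
    case less
    obtain z where z: "u < z" "z < x" "E x - E u = (x - u) * E' z"
      using MVT2[OF less, of E E'] D assms by auto
    have "\<bar>E u - E x\<bar> = \<bar>u - x\<bar> * \<bar>E' z\<bar>"
      by (subst abs_minus_commute) (simp add: z(3) abs_mult abs_minus_commute)
    with bd[of z] z show ?thesis by (simp add: mult_left_mono)
  next
    case greater
    obtain z where z: "x < z" "z < u" "E u - E x = (u - x) * E' z"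
      using MVT2[OF greater, of E E'] D assms by auto
    have "\<bar>E u - E x\<bar> = \<bar>u - x\<bar> * \<bar>E' z\<bar>" by (simp add: z(3) abs_mult)
    with bd[of z] z show ?thesis by (simp add: mult_left_mono)
  qed simp
  then show ?thesis by (simp add: Ex) (simp add: E_def)
qed

text \<open>When \<open>u - x\<close> has order \<open>sqrt k\<close> and \<open>x = k m\<close>, the error in \<open>ln_poisson_ratio_quadratic\<close> has order
  \<open>1 / sqrt k\<close>, so only the quadratic term survives.\<close>

lemma poisson_ratio_local_limit:
  fixes m t :: real and u :: "nat \<Rightarrow> real"
  assumes m: "0 < m" and t: "(\<lambda>k. (u k - real k * m) / sqrt (real k)) \<longlonglongrightarrow> t"
  shows "(\<lambda>k. poisson_ratio (real k * m) (u k)) \<longlonglongrightarrow> exp (- t\<^sup>2 / (2 * m))"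
    and "eventually (\<lambda>k. 0 < u k) sequentially"
proof -
  define v where "v = (\<lambda>k. (u k - real k * m) / sqrt (real k))"
  have v: "v \<longlonglongrightarrow> t" using t by (simp add: v_def)
  have inv: "(\<lambda>k. 1 / sqrt (real k)) \<longlonglongrightarrow> 0"
    by (intro tendsto_divide_0[OF tendsto_const] filterlim_at_top_imp_at_infinity
        filterlim_compose[OF sqrt_at_top filterlim_real_sequentially])
  \<comment> \<open>Chosen such that \<open>u k = k l\<^sub>k\<close>.\<close>
  define l where "l = (\<lambda>k. m + v k * (1 / sqrt (real k)))"
  have "l \<longlonglongrightarrow> m + t * 0" unfolding l_def by (intro tendsto_intros v inv)
  then have l: "l \<longlonglongrightarrow> m" by simp
  have ev: "eventually (\<lambda>k. 0 < k \<and> 0 < l k) sequentially"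
    using eventually_gt_at_top[of 0] order_tendstoD(1)[OF l m] by eventually_elim auto
  have u: "u k = real k * l k" "u k - real k * m = sqrt (real k) * v k" if "0 < k" for k
    using that by (simp_all add: l_def v_def field_simps)
  show evu: "eventually (\<lambda>k. 0 < u k) sequentially"
    using ev by eventually_elim (simp add: u)
  define e where "e = (\<lambda>k. \<bar>v k\<bar> * (1 / sqrt (real k)) * (1 / m + (v k)\<^sup>2 / (m * min m (l k))))"
  have "e \<longlonglongrightarrow> \<bar>t\<bar> * 0 * (1 / m + t\<^sup>2 / (m * min m m))"
    unfolding e_def using m by (intro tendsto_intros v inv l) auto
  then have e: "e \<longlonglongrightarrow> 0" by simp
  have "(\<lambda>k. ln_poisson_ratio (real k * m) (u k) + (v k)\<^sup>2 / (2 * m)) \<longlonglongrightarrow> 0"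
  proof (rule Lim_null_comparison[OF _ e])
    show "eventually (\<lambda>k. norm (ln_poisson_ratio (real k * m) (u k) + (v k)\<^sup>2 / (2 * m)) \<le> e k) sequentially"
      using ev evu
    proof eventually_elim
      case (elim k)
      then have k: "0 < real k" by simp
      have sq: "(u k - real k * m)\<^sup>2 = real k * (v k)\<^sup>2"
        using elim by (simp add: u(2) power_mult_distrib)
      have 1: "(u k - real k * m)\<^sup>2 / (2 * (real k * m)) = (v k)\<^sup>2 / (2 * m)"
        unfolding sq using k by simp
      have "min (real k * m) (u k) = real k * min m (l k)"
        using elim by (simp add: u min_mult_distrib_left)
      then have b: "1 / (real k * m) + (u k - real k * m)\<^sup>2 / (real k * m * min (real k * m) (u k))
          = 1 / real k * (1 / m + (v k)\<^sup>2 / (m * min m (l k)))"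
        unfolding sq using k m elim by (simp add: field_simps)
      have a: "\<bar>u k - real k * m\<bar> = sqrt (real k) * \<bar>v k\<bar>"
        using elim by (simp add: u(2) abs_mult)
      have c: "1 / sqrt (real k) = sqrt (real k) * (1 / real k)"
        using sqrt_divide_self_eq[of "real k"] k by (simp add: divide_inverse)
      have "\<bar>u k - real k * m\<bar> * (1 / (real k * m) + (u k - real k * m)\<^sup>2 / (real k * m * min (real k * m) (u k))) = e k"
        unfolding e_def a b c by (simp only: mult_ac)
      with ln_poisson_ratio_quadratic[of "real k * m" "u k"] 1 elim k m
      show ?case by simp
    qed
  qed
  from tendsto_diff[OF this tendsto_divide[OF tendsto_power[OF v, of 2] tendsto_const, of "2 * m"]] m
  have "(\<lambda>k. ln_poisson_ratio (real k * m) (u k)) \<longlonglongrightarrow> - t\<^sup>2 / (2 * m)" by simp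
  from tendsto_exp[OF this]
  show "(\<lambda>k. poisson_ratio (real k * m) (u k)) \<longlonglongrightarrow> exp (- t\<^sup>2 / (2 * m))"
  proof (rule Lim_transform_eventually)
    show "eventually (\<lambda>k. exp (ln_poisson_ratio (real k * m) (u k)) = poisson_ratio (real k * m) (u k)) sequentially"
      using ev evu by eventually_elim (simp add: poisson_ratio_eq_exp m)
  qed
qed

lemma poisson_ratio_neg_int:
  assumes "u \<in> \<int>" "u < 0"
  shows "poisson_ratio x u = 0"
proof -
  obtain j where j: "u = of_int j" using assms(1) by (auto elim: Ints_cases)
  then have "j + 1 \<le> 0" using assms(2) by simp
  then have "u + 1 \<in> \<int>\<^sub>\<le>\<^sub>0" unfolding j by (intro nonpos_Ints_of_int[of "j + 1", simplified])
  then show ?thesis by (simp add: poisson_ratio_def rGamma_eq_zero_iff)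
qed

lemma poisson_ratio_nonneg:
  assumes "0 < x" "u \<in> \<int>"
  shows "0 \<le> poisson_ratio x u"
  using poisson_ratio_neg_int[OF assms(2), of x] poisson_ratio_eq_exp[OF assms(1), of u]
  by (cases "u < 0") auto

section \<open>Gaussian integrals of quadratic forms\<close>

definition quad_form :: "nat \<Rightarrow> (nat \<Rightarrow> nat \<Rightarrow> real) \<Rightarrow> (nat \<Rightarrow> real) \<Rightarrow> real" where
  "quad_form r q s = (\<Sum>l<r. \<Sum>l'<r. q l l' * s l * s l')"

definition pos_def_form :: "nat \<Rightarrow> (nat \<Rightarrow> nat \<Rightarrow> real) \<Rightarrow> bool" where
  "pos_def_form r q \<longleftrightarrow> (\<forall>l<r. \<forall>l'<r. q l l' = q l' l) \<and>
     (\<forall>s. (\<exists>l<r. s l \<noteq> 0) \<longrightarrow> 0 < quad_form r q s)"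

definition schur_complement :: "nat \<Rightarrow> (nat \<Rightarrow> nat \<Rightarrow> real) \<Rightarrow> nat \<Rightarrow> nat \<Rightarrow> real" where
  "schur_complement r q l l' = q l l' - q l r * q r l' / q r r"

text \<open>Completing the square turns the integrand into a multiple of a normal density.\<close>

lemma nn_integral_gaussian_linear:
  fixes a b c :: real
  assumes "0 < a"
  shows "(\<integral>\<^sup>+y. ennreal (exp (- (a * y\<^sup>2 + 2 * b * y + c) / 2)) \<partial>lborel)
    = ennreal (sqrt (2 * pi / a) * exp (- (c - b\<^sup>2 / a) / 2))"
proof -
  have eq: "exp (- (a * y\<^sup>2 + 2 * b * y + c) / 2) =
      sqrt (2 * pi / a) * exp (- (c - b\<^sup>2 / a) / 2) * normal_density (- b / a) (1 / sqrt a) y" for y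
  proof -
    have "- (c - b\<^sup>2 / a) / 2 + - (y - - b / a)\<^sup>2 / (2 * (1 / sqrt a)\<^sup>2)
        = - (a * y\<^sup>2 + 2 * b * y + c) / 2"
      using assms by (simp add: power_divide field_simps power2_eq_square)
    moreover have "2 * pi * (1 / sqrt a)\<^sup>2 = 2 * pi / a" using assms by (simp add: power_divide)
    moreover have "sqrt (2 * pi / a) \<noteq> 0" using assms by simp
    ultimately show ?thesis
      unfolding normal_density_def by (simp add: exp_add[symmetric])
  qed
  have "(\<integral>\<^sup>+y. ennreal (normal_density (- b / a) (1 / sqrt a) y) \<partial>lborel) = 1"
    using assms by (subst nn_integral_eq_integral) auto
  moreover have "(\<integral>\<^sup>+y. ennreal (exp (- (a * y\<^sup>2 + 2 * b * y + c) / 2)) \<partial>lborel)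
     = ennreal (sqrt (2 * pi / a) * exp (- (c - b\<^sup>2 / a) / 2)) *
       (\<integral>\<^sup>+y. ennreal (normal_density (- b / a) (1 / sqrt a) y) \<partial>lborel)"
    unfolding eq using assms
    by (subst nn_integral_cmult[symmetric]) (auto simp: ennreal_mult' intro!: nn_integral_cong)
  ultimately show ?thesis by simp
qed

lemma quad_form_Suc:
  assumes "\<And>l. l < r \<Longrightarrow> q l r = q r l"
  shows "quad_form (Suc r) q s =
    q r r * (s r)\<^sup>2 + 2 * (\<Sum>l<r. q l r * s l) * s r + quad_form r q s"
proof -
  have 1: "(\<Sum>l<r. q l r * s l * s r) = (\<Sum>l<r. q l r * s l) * s r"
    by (simp add: sum_distrib_right)
  have 2: "(\<Sum>l<r. q r l * s r * s l) = (\<Sum>l<r. q l r * s l) * s r"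
    unfolding sum_distrib_right using assms by (intro sum.cong) (auto simp: mult_ac)
  show ?thesis
    by (simp add: quad_form_def sum.distrib 1 2 power2_eq_square)
qed

lemma quad_form_schur_complement:
  assumes "\<And>l. l < r \<Longrightarrow> q l r = q r l"
  shows "quad_form r (schur_complement r q) s = quad_form r q s - (\<Sum>l<r. q l r * s l)\<^sup>2 / q r r"
proof -
  have "(\<Sum>l<r. q l r * s l)\<^sup>2 / q r r = (\<Sum>l<r. \<Sum>l'<r. q l r * s l * (q l' r * s l') / q r r)"
    by (simp add: power2_eq_square sum_product sum_divide_distrib)
  also have "\<dots> = (\<Sum>l<r. \<Sum>l'<r. q l r * q r l' / q r r * s l * s l')"
    using assms by (intro sum.cong refl) auto
  finally show ?thesis
    by (simp add: quad_form_def schur_complement_def sum_subtractf[symmetric] algebra_simps)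
qed

lemma quad_form_cong:
  "(\<And>l. l < r \<Longrightarrow> s l = s' l) \<Longrightarrow> quad_form r q s = quad_form r q s'"
  by (simp add: quad_form_def)

text \<open>The value at the last unit vector is the pivot.  Setting the last variable to the minimizer
  \<open>- (\<Sum>l<r. q l r * s l) / q r r\<close> shows that the Schur complement inherits positivity.\<close>

lemma pos_def_form_Suc:
  assumes "pos_def_form (Suc r) q"
  shows "0 < q r r" "pos_def_form r (schur_complement r q)" "\<And>l. l < r \<Longrightarrow> q l r = q r l"
proof -
  show sym: "q l r = q r l" if "l < r" for l using assms that by (simp add: pos_def_form_def)
  have "0 < quad_form (Suc r) q (\<lambda>l. if l = r then 1 else 0)"
    using assms unfolding pos_def_form_def by auto
  also have "\<dots> = q r r"
    by (subst quad_form_Suc[of r q, OF sym]) (simp_all add: quad_form_def)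
  finally show pos: "0 < q r r" .
  have "0 < quad_form r (schur_complement r q) s" if "\<exists>l<r. s l \<noteq> 0" for s
  proof -
    let ?b = "\<Sum>l<r. q l r * s l"
    let ?s = "s(r := - ?b / q r r)"
    have "\<exists>l<Suc r. ?s l \<noteq> 0" using that by (metis fun_upd_other less_SucI less_irrefl)
    then have "0 < quad_form (Suc r) q ?s" using assms unfolding pos_def_form_def by blast
    also have "\<dots> = q r r * (- ?b / q r r)\<^sup>2 + 2 * ?b * (- ?b / q r r) + quad_form r q s"
      by (subst quad_form_Suc[of r q, OF sym]) (auto intro: quad_form_cong)
    also have "\<dots> = quad_form r (schur_complement r q) s"
      using pos by (subst quad_form_schur_complement[of r q, OF sym]) (auto simp: field_simps power2_eq_square)
    finally show ?thesis .
  qed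
  then show "pos_def_form r (schur_complement r q)"
    using assms unfolding pos_def_form_def schur_complement_def by simp
qed

text \<open>Right multiplication by a unipotent lower triangular matrix clears the last row except for the
  pivot and leaves the Schur complement in the upper left block.\<close>

lemma det_schur_complement:
  fixes q :: "nat \<Rightarrow> nat \<Rightarrow> real"
  assumes nz: "q r r \<noteq> 0"
  shows "Determinant.det (Matrix.mat (Suc r) (Suc r) (\<lambda>(i, j). q i j)) =
    q r r * Determinant.det (Matrix.mat r r (\<lambda>(i, j). schur_complement r q i j))"
proof -
  let ?M = "Matrix.mat (Suc r) (Suc r) (\<lambda>(i, j). q i j)"
  define U where "U = Matrix.mat (Suc r) (Suc r)
    (\<lambda>(k, j). if k = j then 1 else if k = r then - q r j / q r r else 0)"
  have U: "U \<in> carrier_mat (Suc r) (Suc r)" by (simp add: U_def)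
  have "Determinant.det U = prod_list (diag_mat U)"
    using U by (intro det_lower_triangular[of "Suc r"]) (auto simp: U_def)
  also have "diag_mat U = map (\<lambda>_. 1) [0..<Suc r]"
    unfolding diag_mat_def by (auto simp: U_def intro!: map_cong simp del: upt_Suc)
  also have "prod_list \<dots> = 1" by (simp add: map_replicate_const del: upt_Suc)
  finally have detU: "Determinant.det U = 1" .
  define P where "P = Matrix.mat (Suc r) (Suc r) (\<lambda>(i, j). if j = r then q i r else schur_complement r q i j)"
  have P: "P \<in> carrier_mat (Suc r) (Suc r)" by (simp add: P_def)
  have "?M * U = P"
  proof (rule eq_matI)
    fix i j assume "i < dim_row P" "j < dim_col P"
    then have ij: "i < Suc r" "j < Suc r" by (auto simp: P_def)
    have "(?M * U) $$ (i, j) = (\<Sum>k<Suc r. q i k * (if k = j then 1 else if k = r then - q r j / q r r else 0))"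
      using ij U by (simp add: scalar_prod_def U_def lessThan_atLeast0 del: sum.op_ivl_Suc)
    also have "\<dots> = (\<Sum>k<Suc r. (if k = j then q i k else 0) + (if k = r then if j = r then 0 else q i k * (- q r j / q r r) else 0))"
      by (intro sum.cong) auto
    also have "\<dots> = q i j + (if j = r then 0 else q i r * (- q r j / q r r))"
      using ij by (subst sum.distrib) (simp add: sum.delta' del: sum.lessThan_Suc)
    also have "\<dots> = P $$ (i, j)" using ij by (simp add: P_def schur_complement_def)
    finally show "(?M * U) $$ (i, j) = P $$ (i, j)" .
  qed (auto simp: P_def U_def)
  then have "Determinant.det ?M = Determinant.det P"
    using det_mult[of ?M "Suc r" U] U detU by simp
  also have "\<dots> = (\<Sum>j<Suc r. P $$ (r, j) * cofactor P r j)"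
    by (rule laplace_expansion_row[OF P]) simp
  also have "\<dots> = (\<Sum>j<Suc r. if j = r then q r r * cofactor P r r else 0)"
    using nz by (intro sum.cong) (auto simp: P_def schur_complement_def)
  also have "\<dots> = q r r * cofactor P r r" by (simp add: sum.delta' del: sum.lessThan_Suc)
  also have "cofactor P r r = Determinant.det (Matrix.mat r r (\<lambda>(i, j). schur_complement r q i j))"
    unfolding cofactor_def by (simp, rule arg_cong[of _ _ Determinant.det], rule eq_matI)
      (auto simp: mat_delete_def P_def)
  finally show ?thesis .
qed

lemma quad_form_measurable [measurable]:
  "quad_form r q \<in> borel_measurable (\<Pi>\<^sub>M l\<in>{..<r}. lborel)"
  unfolding quad_form_def[abs_def] by measurable

text \<open>Integrating out the last variable replaces the form by its Schur complement and produces the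
  factor \<open>sqrt (2 * pi / q r r)\<close>; correspondingly the determinant loses the pivot \<open>q r r\<close>.\<close>

lemma gaussian_integral_quad_form:
  assumes "pos_def_form r q"
  shows "0 < Determinant.det (Matrix.mat r r (\<lambda>(i, j). q i j))" (is ?pos)
    "(\<integral>\<^sup>+s. ennreal (exp (- quad_form r q s / 2)) \<partial>(\<Pi>\<^sub>M l\<in>{..<r}. lborel)) =
       ennreal (sqrt ((2 * pi) ^ r / Determinant.det (Matrix.mat r r (\<lambda>(i, j). q i j))))" (is ?int)
proof -
  have "?pos \<and> ?int" using assms
  proof (induction r arbitrary: q)
    case 0
    interpret product_sigma_finite "\<lambda>_::nat. lborel :: real measure" ..
    show ?case
      by (simp add: quad_form_def nn_integral_empty space_PiM_empty)
  next
    case (Suc r)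
    interpret product_sigma_finite "\<lambda>_::nat. lborel :: real measure" ..
    note pd = pos_def_form_Suc[OF Suc.prems]
    let ?S = "schur_complement r q"
    let ?d = "Determinant.det (Matrix.mat r r (\<lambda>(i, j). ?S i j))"
    have IH: "0 < ?d" "(\<integral>\<^sup>+s. ennreal (exp (- quad_form r ?S s / 2)) \<partial>(\<Pi>\<^sub>M l\<in>{..<r}. lborel)) =
       ennreal (sqrt ((2 * pi) ^ r / ?d))"
      using Suc.IH[OF pd(2)] by auto
    have det: "Determinant.det (Matrix.mat (Suc r) (Suc r) (\<lambda>(i, j). q i j)) = q r r * ?d"
      using pd(1) by (intro det_schur_complement) auto
    have "(\<integral>\<^sup>+s. ennreal (exp (- quad_form (Suc r) q s / 2)) \<partial>(\<Pi>\<^sub>M l\<in>{..<Suc r}. lborel)) =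
      (\<integral>\<^sup>+s. (\<integral>\<^sup>+y. ennreal (exp (- quad_form (Suc r) q (s(r := y)) / 2)) \<partial>lborel) \<partial>(\<Pi>\<^sub>M l\<in>{..<r}. lborel))"
      unfolding lessThan_Suc
      by (rule product_nn_integral_insert) (auto simp flip: lessThan_Suc)
    also have "\<dots> = (\<integral>\<^sup>+s. ennreal (sqrt (2 * pi / q r r)) * ennreal (exp (- quad_form r ?S s / 2)) \<partial>(\<Pi>\<^sub>M l\<in>{..<r}. lborel))"
    proof (rule nn_integral_cong)
      fix s :: "nat \<Rightarrow> real"
      let ?b = "\<Sum>l<r. q l r * s l"
      have "quad_form (Suc r) q (s(r := y)) = q r r * y\<^sup>2 + 2 * ?b * y + quad_form r q s" for y
        by (subst quad_form_Suc[of r q, OF pd(3)]) (auto intro: quad_form_cong)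
      then have "(\<integral>\<^sup>+y. ennreal (exp (- quad_form (Suc r) q (s(r := y)) / 2)) \<partial>lborel) =
        ennreal (sqrt (2 * pi / q r r) * exp (- (quad_form r q s - ?b\<^sup>2 / q r r) / 2))"
        using nn_integral_gaussian_linear[OF pd(1)] by simp
      also have "quad_form r q s - ?b\<^sup>2 / q r r = quad_form r ?S s"
        by (rule quad_form_schur_complement[of r q, OF pd(3), symmetric])
      finally show "(\<integral>\<^sup>+y. ennreal (exp (- quad_form (Suc r) q (s(r := y)) / 2)) \<partial>lborel) =
        ennreal (sqrt (2 * pi / q r r)) * ennreal (exp (- quad_form r ?S s / 2))"
        using pd(1) by (simp add: ennreal_mult' del: fun_upd_apply)
    qed
    also have "\<dots> = ennreal (sqrt (2 * pi / q r r)) * ennreal (sqrt ((2 * pi) ^ r / ?d))"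
      by (subst nn_integral_cmult, measurable) (simp only: IH(2))
    also have "\<dots> = ennreal (sqrt ((2 * pi) ^ Suc r / (q r r * ?d)))"
      using pd(1) IH(1) by (simp add: ennreal_mult'[symmetric] real_sqrt_mult[symmetric])
    finally show ?case using det pd(1) IH(1) by simp
  qed
  then show ?pos ?int by auto
qed

section \<open>Matrices with orthogonal row spaces\<close>

lemma sum_lessThan_add:
  fixes f :: "nat \<Rightarrow> 'a::comm_monoid_add"
  shows "(\<Sum>j<d + r. f j) = (\<Sum>j<d. f j) + (\<Sum>l<r. f (d + l))"
  by (induction r) (simp_all add: add.assoc)

text \<open>Matrix inversion for matrices and vectors given by their entry functions.\<close>

lemma trivial_kernel_imp_inverse:
  fixes K :: "nat \<Rightarrow> nat \<Rightarrow> real"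
  assumes ker: "\<And>v j. (\<And>i. i < n \<Longrightarrow> (\<Sum>j<n. K i j * v j) = 0) \<Longrightarrow> j < n \<Longrightarrow> v j = 0"
  obtains W where "\<And>x i. i < n \<Longrightarrow> (\<Sum>j<n. K i j * (\<Sum>k<n. W j k * x k)) = x i"
    and "\<And>v j. j < n \<Longrightarrow> (\<Sum>i<n. W j i * (\<Sum>k<n. K i k * v k)) = v j"
proof -
  let ?M = "Matrix.mat n n (\<lambda>(i, j). K i j)"
  have M: "?M \<in> carrier_mat n n" by simp
  have ent: "(N *\<^sub>v v) $ i = (\<Sum>j<n. N $$ (i, j) * v $ j)"
    if "N \<in> carrier_mat n n" "v \<in> carrier_vec n" "i < n" for N v and i :: nat
    using that by (auto simp: scalar_prod_def lessThan_atLeast0)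
  have "Determinant.det ?M \<noteq> 0"
  proof
    assume "Determinant.det ?M = 0"
    then obtain v where v: "v \<in> carrier_vec n" "v \<noteq> 0\<^sub>v n" "?M *\<^sub>v v = 0\<^sub>v n"
      using det_0_iff_vec_prod_zero_field[OF M] by blast
    have "(\<Sum>j<n. K i j * v $ j) = 0" if "i < n" for i
      using ent[OF M v(1) that] v(3) that by simp
    then have "v $ j = 0" if "j < n" for j using ker that by blast
    then have "v = 0\<^sub>v n" using v(1) by auto
    with v(2) show False ..
  qed
  from det_non_zero_imp_unit[OF M this, of "()"]
  obtain N where N: "N \<in> carrier_mat n n" and NM: "N * ?M = 1\<^sub>m n" and MN: "?M * N = 1\<^sub>m n"
    unfolding Units_def ring_mat_def by auto
  have assoc: "P *\<^sub>v (Q *\<^sub>v x) = x"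
    if "P * Q = 1\<^sub>m n" "P \<in> carrier_mat n n" "Q \<in> carrier_mat n n" "x \<in> carrier_vec n" for P Q and x :: "real Matrix.vec"
    using that assoc_mult_mat_vec[of P n n Q n x] by simp
  show ?thesis
  proof (rule that[of "\<lambda>i j. N $$ (i, j)"])
    fix x :: "nat \<Rightarrow> real" and i assume i: "i < n"
    have "(?M *\<^sub>v (N *\<^sub>v Matrix.vec n x)) $ i = x i"
      using assoc[OF MN M N, of "Matrix.vec n x"] i by simp
    then show "(\<Sum>j<n. K i j * (\<Sum>k<n. N $$ (j, k) * x k)) = x i"
      using i N by (subst (asm) ent[OF M]) (auto simp: ent[OF N] simp del: index_mult_mat_vec)
    have "(N *\<^sub>v (?M *\<^sub>v Matrix.vec n x)) $ i = x i"
      using assoc[OF NM N M, of "Matrix.vec n x"] i by simp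
    then show "(\<Sum>j<n. N $$ (i, j) * (\<Sum>k<n. K j k * x k)) = x i"
      using i N ent[OF N, of "?M *\<^sub>v Matrix.vec n x" i]
      by (auto simp: ent[OF M] mult_mat_vec_carrier[OF M] simp del: index_mult_mat_vec)
  qed
qed

text \<open>The vector \<open>b\<^sup>T c\<close>, where \<open>b\<close> is the entry function of a matrix with \<open>r\<close> rows.\<close>

definition row_comb :: "nat \<Rightarrow> (nat \<Rightarrow> nat \<Rightarrow> real) \<Rightarrow> (nat \<Rightarrow> real) \<Rightarrow> nat \<Rightarrow> real" where
  "row_comb r b c i = (\<Sum>l<r. b l i * c l)"

lemma sum_mult_row_comb:
  "(\<Sum>i<n. x i * row_comb r b c i) = (\<Sum>l<r. c l * (\<Sum>i<n. b l i * x i))"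
  unfolding row_comb_def sum_distrib_left
  by (subst sum.swap) (simp add: mult_ac)

text \<open>The Gram determinant is an integer, hence nonzero over the reals once it is nonzero over the
  integers.  There, a kernel vector \<open>v\<close> of the Gram matrix would give \<open>\<bar>b\<^sup>T v\<bar>\<^sup>2 = 0\<close>.\<close>

lemma int_independent_imp_real_independent:
  fixes b :: "nat \<Rightarrow> nat \<Rightarrow> int"
  assumes indep: "\<And>c l. (\<And>i. i < n \<Longrightarrow> (\<Sum>l<r. b l i * c l) = 0) \<Longrightarrow> l < r \<Longrightarrow> c l = (0::int)"
    and s: "\<And>i. i < n \<Longrightarrow> row_comb r (\<lambda>l i. real_of_int (b l i)) s i = 0" and l: "l < r"
  shows "s l = 0"
proof -
  let ?G = "Matrix.mat r r (\<lambda>(l, l'). \<Sum>i<n. b l i * b l' i)"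
  have G: "?G \<in> carrier_mat r r" by simp
  have "Determinant.det ?G \<noteq> 0"
  proof
    assume "Determinant.det ?G = 0"
    then obtain v where v: "v \<in> carrier_vec r" "v \<noteq> 0\<^sub>v r" "?G *\<^sub>v v = 0\<^sub>v r"
      using det_0_iff_vec_prod_zero[OF G] by blast
    have Gv: "(\<Sum>l'<r. (\<Sum>i<n. b l i * b l' i) * v $ l') = 0" if "l < r" for l
    proof -
      have "(?G *\<^sub>v v) $ l = 0" using v(3) that by simp
      then show ?thesis using that v(1) by (simp add: scalar_prod_def lessThan_atLeast0)
    qed
    have "(\<Sum>i<n. (\<Sum>l<r. b l i * v $ l)\<^sup>2) = (\<Sum>i<n. \<Sum>l<r. \<Sum>l'<r. v $ l * (b l i * b l' i * v $ l'))"
      by (simp add: power2_eq_square sum_product mult_ac)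
    also have "\<dots> = (\<Sum>l<r. \<Sum>i<n. \<Sum>l'<r. v $ l * (b l i * b l' i * v $ l'))"
      by (rule sum.swap)
    also have "\<dots> = (\<Sum>l<r. \<Sum>l'<r. \<Sum>i<n. v $ l * (b l i * b l' i * v $ l'))"
      by (intro sum.cong refl sum.swap)
    also have "\<dots> = (\<Sum>l<r. v $ l * (\<Sum>l'<r. (\<Sum>i<n. b l i * b l' i) * v $ l'))"
      by (simp add: sum_distrib_left sum_distrib_right)
    also have "\<dots> = 0" using Gv by simp
    finally have "\<And>i. i < n \<Longrightarrow> (\<Sum>l<r. b l i * v $ l) = 0"
      by (subst (asm) sum_nonneg_eq_0_iff) auto
    from indep[OF this] have "v $ l = 0" if "l < r" for l using that by blast
    then have "v = 0\<^sub>v r" using v(1) by auto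
    with v(2) show False ..
  qed
  then have "Determinant.det (map_mat real_of_int ?G) \<noteq> 0" by (simp add: of_int_hom.hom_det)
  moreover have "map_mat real_of_int ?G *\<^sub>v Matrix.vec r s = 0\<^sub>v r"
  proof (rule eq_vecI)
    fix l assume "l < dim_vec (0\<^sub>v r :: real Matrix.vec)"
    then have l: "l < r" by simp
    have "(map_mat real_of_int ?G *\<^sub>v Matrix.vec r s) $ l = (\<Sum>l'<r. (\<Sum>i<n. of_int (b l i) * of_int (b l' i)) * s l')"
      using l by (simp add: scalar_prod_def lessThan_atLeast0)
    also have "\<dots> = (\<Sum>i<n. of_int (b l i) * row_comb r (\<lambda>l i. real_of_int (b l i)) s i)"
      unfolding row_comb_def sum_distrib_left sum_distrib_right
      by (subst sum.swap) (simp add: mult_ac)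
    also have "\<dots> = 0" using s by simp
    finally show "(map_mat real_of_int ?G *\<^sub>v Matrix.vec r s) $ l = 0\<^sub>v r $ l" using l by simp
  qed simp
  moreover have "map_mat real_of_int ?G \<in> carrier_mat r r" by simp
  ultimately have "Matrix.vec r s = 0\<^sub>v r"
    using det_0_iff_vec_prod_zero_field[of "map_mat real_of_int ?G" r] vec_carrier[of r s] by blast
  then have "Matrix.vec r s $ l = 0" using l by simp
  then show ?thesis using l by simp
qed

text \<open>Two independent families of rows that span orthogonal complements of each other in \<open>\<real>\<^sup>n\<close>: below,
  the rows of a configuration matrix and those of its Gale transform.\<close>

locale orthogonal_row_families =
  fixes a b :: "nat \<Rightarrow> nat \<Rightarrow> real" and d r n :: nat
  assumes dim: "d + r = n"
    and orth: "\<And>j l. j < d \<Longrightarrow> l < r \<Longrightarrow> (\<Sum>i<n. a j i * b l i) = 0"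
    and indep_a: "\<And>y j. (\<And>i. i < n \<Longrightarrow> row_comb d a y i = 0) \<Longrightarrow> j < d \<Longrightarrow> y j = 0"
    and indep_b: "\<And>c l. (\<And>i. i < n \<Longrightarrow> row_comb r b c i = 0) \<Longrightarrow> l < r \<Longrightarrow> c l = 0"
begin

lemma swap: "orthogonal_row_families b a r d n"
proof
  show "r + d = n" using dim by simp
  show "(\<Sum>i<n. b j i * a l i) = 0" if "j < r" "l < d" for j l
    using orth[OF that(2,1)] by (simp add: mult.commute)
qed (fact indep_b, fact indep_a)

lemma row_combs_orthogonal: "(\<Sum>i<n. row_comb d a y i * row_comb r b c i) = 0"
proof -
  have "(\<Sum>i<n. b l i * row_comb d a y i) = 0" if "l < r" for l
    unfolding sum_mult_row_comb[of "b l"] using that orth by simp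
  then show ?thesis by (subst sum_mult_row_comb) simp
qed

text \<open>If \<open>a\<^sup>T y + b\<^sup>T c = 0\<close>, then \<open>\<bar>a\<^sup>T y\<bar>\<^sup>2 = - \<langle>a\<^sup>T y, b\<^sup>T c\<rangle> = 0\<close> by orthogonality, so that \<open>y\<close> and \<open>c\<close>
  vanish.  Hence the square matrix made of all the rows is invertible, which gives both a
  decomposition of every vector and a formula for the coefficients.\<close>

lemma stacked_rows_invertible:
  obtains W where
    "\<And>x i. i < n \<Longrightarrow> row_comb d a (\<lambda>j. \<Sum>k<n. W j k * x k) i + row_comb r b (\<lambda>l. \<Sum>k<n. W (d + l) k * x k) i = x i"
    "\<And>y c j. j < d \<Longrightarrow> (\<Sum>i<n. W j i * (row_comb d a y i + row_comb r b c i)) = y j"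
proof -
  \<comment> \<open>The columns of \<open>K\<close> are the rows of \<open>a\<close> followed by those of \<open>b\<close>.\<close>
  define K where "K = (\<lambda>i j. if j < d then a j i else b (j - d) i)"
  have K: "(\<Sum>j<n. K i j * v j) = row_comb d a v i + row_comb r b (\<lambda>l. v (d + l)) i" for i v
    unfolding dim[symmetric] sum_lessThan_add by (simp add: K_def row_comb_def)
  have ker: "v j = 0" if 0: "\<And>i. i < n \<Longrightarrow> (\<Sum>j<n. K i j * v j) = 0" and j: "j < n" for v j
  proof -
    let ?y = "row_comb d a v" and ?c = "row_comb r b (\<lambda>l. v (d + l))"
    have yc: "?c i = - ?y i" if "i < n" for i using 0[OF that] by (simp add: K)
    have "(\<Sum>i<n. (?y i)\<^sup>2) = - (\<Sum>i<n. ?y i * ?c i)"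
        unfolding sum_negf[symmetric] by (intro sum.cong refl) (simp add: yc power2_eq_square)
    also have "\<dots> = 0" by (simp add: row_combs_orthogonal)
    finally have y0: "\<And>i. i < n \<Longrightarrow> ?y i = 0" by (subst (asm) sum_nonneg_eq_0_iff) auto
    with yc have c0: "\<And>i. i < n \<Longrightarrow> ?c i = 0" by simp
    show ?thesis
    proof (cases "j < d")
      case True then show ?thesis using indep_a[OF y0] by blast
    next
      case False
      then have "j - d < r" using j dim by simp
      then have "v (d + (j - d)) = 0" using indep_b[OF c0] by blast
      then show ?thesis using False by simp
    qed
  qed
  obtain W where W: "\<And>x i. i < n \<Longrightarrow> (\<Sum>j<n. K i j * (\<Sum>k<n. W j k * x k)) = x i"
    "\<And>v j. j < n \<Longrightarrow> (\<Sum>i<n. W j i * (\<Sum>k<n. K i k * v k)) = v j"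
  proof (rule trivial_kernel_imp_inverse[of n K])
    show "v j = 0" if "\<And>i. i < n \<Longrightarrow> (\<Sum>j<n. K i j * v j) = 0" "j < n" for v j
      by (rule ker[of v j]) (use that in auto)
  qed (rule that)
  show ?thesis
  proof (rule that[of W])
    show "row_comb d a (\<lambda>j. \<Sum>k<n. W j k * x k) i + row_comb r b (\<lambda>l. \<Sum>k<n. W (d + l) k * x k) i = x i"
      if "i < n" for x i using W(1)[OF that, of x] unfolding K .
    show "(\<Sum>i<n. W j i * (row_comb d a y i + row_comb r b c i)) = y j" if "j < d" for y c j
    proof -
      let ?v = "\<lambda>j. if j < d then y j else c (j - d)"
      have "row_comb d a ?v i = row_comb d a y i" "row_comb r b (\<lambda>l. ?v (d + l)) i = row_comb r b c i" for i
        by (simp_all add: row_comb_def)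
      then show ?thesis using W(2)[of j ?v] that dim unfolding K by simp
    qed
  qed
qed

text \<open>The entries of the inverse of the stacked matrix bound the coefficients of a combination by its
  coordinates.\<close>

lemma row_comb_coercive:
  obtains C where "0 < C" "\<And>y j. j < d \<Longrightarrow> \<bar>y j\<bar> \<le> C * (\<Sum>i<n. \<bar>row_comb d a y i\<bar>)"
proof -
  obtain W where
    "\<And>x i. i < n \<Longrightarrow> row_comb d a (\<lambda>j. \<Sum>k<n. W j k * x k) i + row_comb r b (\<lambda>l. \<Sum>k<n. W (d + l) k * x k) i = x i"
    and W: "\<And>y c j. j < d \<Longrightarrow> (\<Sum>i<n. W j i * (row_comb d a y i + row_comb r b c i)) = y j"
    by (rule stacked_rows_invertible) (rule that)
  define C where "C = 1 + (\<Sum>j<d. \<Sum>i<n. \<bar>W j i\<bar>)"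
  have nn: "0 \<le> (\<Sum>j<d. \<Sum>i<n. \<bar>W j i\<bar>)" by (intro sum_nonneg) auto
  have le: "\<bar>W j i\<bar> \<le> C" if "j < d" "i < n" for j i
  proof -
    have "\<bar>W j i\<bar> \<le> (\<Sum>i<n. \<bar>W j i\<bar>)" using that by (intro member_le_sum) auto
    also have "\<dots> \<le> (\<Sum>j<d. \<Sum>i<n. \<bar>W j i\<bar>)"
      using that by (intro member_le_sum[of j "{..<d}" "\<lambda>j. \<Sum>i<n. \<bar>W j i\<bar>"]) (auto intro: sum_nonneg)
    finally show ?thesis by (simp add: C_def)
  qed
  show ?thesis
  proof (rule that[of C])
    fix y j assume j: "j < d"
    have "\<bar>y j\<bar> = \<bar>\<Sum>i<n. W j i * row_comb d a y i\<bar>"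
      using W[OF j, of y "\<lambda>_. 0"] by (simp add: row_comb_def)
    also have "\<dots> \<le> (\<Sum>i<n. \<bar>W j i\<bar> * \<bar>row_comb d a y i\<bar>)"
      by (rule order_trans[OF sum_abs]) (simp add: abs_mult)
    also have "\<dots> \<le> (\<Sum>i<n. C * \<bar>row_comb d a y i\<bar>)"
      using le j by (intro sum_mono mult_right_mono) auto
    finally show "\<bar>y j\<bar> \<le> C * (\<Sum>i<n. \<bar>row_comb d a y i\<bar>)" by (simp add: sum_distrib_left)
  qed (use nn in \<open>simp add: C_def\<close>)
qed

text \<open>Decompose \<open>x = a\<^sup>T y + b\<^sup>T c\<close>; pairing with \<open>a\<^sup>T y\<close> gives \<open>\<bar>a\<^sup>T y\<bar>\<^sup>2 = 0\<close>.\<close>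

lemma orthogonal_to_a_imp_row_comb_b:
  assumes x: "\<And>j. j < d \<Longrightarrow> (\<Sum>i<n. a j i * x i) = 0"
  obtains c where "\<And>i. i < n \<Longrightarrow> x i = row_comb r b c i"
proof -
  obtain W where W: "\<And>x i. i < n \<Longrightarrow>
      row_comb d a (\<lambda>j. \<Sum>k<n. W j k * x k) i + row_comb r b (\<lambda>l. \<Sum>k<n. W (d + l) k * x k) i = x i"
    and "\<And>y c j. j < d \<Longrightarrow> (\<Sum>i<n. W j i * (row_comb d a y i + row_comb r b c i)) = y j"
    by (rule stacked_rows_invertible) (rule that)
  define y where "y = (\<lambda>j. \<Sum>k<n. W j k * x k)"
  define c where "c = (\<lambda>l. \<Sum>k<n. W (d + l) k * x k)"
  have yc: "x i = row_comb d a y i + row_comb r b c i" if "i < n" for i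
    unfolding y_def c_def by (rule W[OF that, symmetric])
  have "0 = (\<Sum>i<n. x i * row_comb d a y i)" using x by (simp add: sum_mult_row_comb)
  also have "\<dots> = (\<Sum>i<n. (row_comb d a y i)\<^sup>2) + (\<Sum>i<n. row_comb d a y i * row_comb r b c i)"
    unfolding sum.distrib[symmetric]
    by (intro sum.cong refl) (simp add: yc algebra_simps power2_eq_square)
  finally have "(\<Sum>i<n. (row_comb d a y i)\<^sup>2) = 0" by (simp add: row_combs_orthogonal)
  then have "\<And>i. i < n \<Longrightarrow> row_comb d a y i = 0" by (subst (asm) sum_nonneg_eq_0_iff) auto
  with yc show ?thesis by (intro that[of c]) simp
qed

end

section \<open>The positive solution of the monomial equations\<close>

text \<open>For \<open>t \<ge> 0\<close>, the inequality \<open>1 + s \<le> exp s\<close> at \<open>s = t - ln (2 * x / p)\<close> puts \<open>2 * x * t\<close> below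
  \<open>p * exp t\<close> up to a constant.\<close>

lemma exp_minus_linear_coercive:
  fixes p x :: real
  assumes "0 < p" "0 < x"
  obtains C where "0 \<le> C" "\<And>t. x * \<bar>t\<bar> - C \<le> p * exp t - x * t"
proof -
  define C where "C = max 0 (2 * x * ln (2 * x / p) - 2 * x)"
  have "x * \<bar>t\<bar> - C \<le> p * exp t - x * t" for t
  proof (cases "0 \<le> t")
    case True
    have "2 * x * (1 + (t - ln (2 * x / p))) \<le> 2 * x * exp (t - ln (2 * x / p))"
      using assms by (intro mult_left_mono exp_ge_add_one_self) auto
    also have "\<dots> = p * exp t" using assms by (simp add: exp_diff)
    finally show ?thesis using True by (simp add: C_def algebra_simps max_def)
  next
    case False
    have "0 < p * exp t" "0 \<le> C" using assms by (auto simp: C_def)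
    then show ?thesis using False by simp
  qed
  moreover have "0 \<le> C" by (simp add: C_def)
  ultimately show ?thesis using that by blast
qed

lemma row_comb_update:
  "j < d \<Longrightarrow> row_comb d a (y(j := y j + t)) i = row_comb d a y i + t * a j i"
proof -
  assume j: "j < d"
  have "row_comb d a (y(j := y j + t)) i = (\<Sum>k<d. a k i * y k + (if k = j then a j i * t else 0))"
    unfolding row_comb_def by (intro sum.cong) (auto simp: algebra_simps)
  also have "\<dots> = row_comb d a y i + t * a j i"
    using j by (simp add: sum.distrib row_comb_def)
  finally show ?thesis .
qed

lemma compact_coordinate_box: "compact (\<Pi>\<^sub>E j\<in>UNIV. if j < d then {- R..R} else {0::real})"
  (is "compact (PiE UNIV ?S)")
proof -
  have "compactin (product_topology (\<lambda>_. euclidean) UNIV) (PiE UNIV ?S)"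
    unfolding compactin_PiE by (auto simp: compactin_euclidean_iff)
  then show ?thesis by (simp add: euclidean_product_topology compactin_euclidean_iff)
qed

context orthogonal_row_families
begin

text \<open>The equations say that \<open>y\<close> is a critical point of
  \<open>\<Sum>\<^sub>i p\<^sub>i exp ((a\<^sup>T y)\<^sub>i) - x\<^sub>i (a\<^sup>T y)\<^sub>i\<close>, the dual of minimizing relative entropy over the
  polytope of nonnegative solutions of \<open>a m = a x\<close>.  As all \<open>x\<^sub>i\<close> are bounded away from \<open>0\<close>, this
  function is coercive, so it has a minimum.\<close>

lemma positive_solution_exists:
  fixes p x :: "nat \<Rightarrow> real"
  assumes p: "\<And>i. i < n \<Longrightarrow> 0 < p i" and e: "0 < e" and x: "\<And>i. i < n \<Longrightarrow> e \<le> x i"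
  obtains y where "\<And>j. j < d \<Longrightarrow>
    (\<Sum>i<n. a j i * (p i * exp (row_comb d a y i))) = (\<Sum>i<n. a j i * x i)"
proof -
  define h where "h = (\<lambda>y. \<Sum>i<n. p i * exp (row_comb d a y i) - x i * row_comb d a y i)"
  have "\<exists>C. \<forall>i<n. 0 \<le> C i \<and> (\<forall>t. x i * \<bar>t\<bar> - C i \<le> p i * exp t - x i * t)"
  proof -
    have "\<exists>C. 0 \<le> C \<and> (\<forall>t. x i * \<bar>t\<bar> - C \<le> p i * exp t - x i * t)" if "i < n" for i
      using exp_minus_linear_coercive[of "p i" "x i"] p[OF that] x[OF that] e
      by (metis less_le_trans)
    then show ?thesis by metis
  qed
  then obtain C where C: "\<And>i t. i < n \<Longrightarrow> x i * \<bar>t\<bar> - C i \<le> p i * exp t - x i * t" by blast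
  obtain K where K: "0 < K" "\<And>y j. j < d \<Longrightarrow> \<bar>y j\<bar> \<le> K * (\<Sum>i<n. \<bar>row_comb d a y i\<bar>)"
    by (rule row_comb_coercive) (rule that)
  have coer: "e / K * \<bar>y j\<bar> - (\<Sum>i<n. C i) \<le> h y" if "j < d" for y j
  proof -
    have "e / K * \<bar>y j\<bar> \<le> e / K * (K * (\<Sum>i<n. \<bar>row_comb d a y i\<bar>))"
      using K e that by (intro mult_left_mono) auto
    also have "\<dots> = (\<Sum>i<n. e * \<bar>row_comb d a y i\<bar>)" using K by (simp add: sum_distrib_left)
    also have "\<dots> \<le> (\<Sum>i<n. x i * \<bar>row_comb d a y i\<bar>)"
      using x by (intro sum_mono mult_right_mono) auto
    also have "\<dots> - (\<Sum>i<n. C i) = (\<Sum>i<n. x i * \<bar>row_comb d a y i\<bar> - C i)"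
      by (simp add: sum_subtractf)
    also have "\<dots> \<le> h y" unfolding h_def using C by (intro sum_mono) auto
    finally show ?thesis by simp
  qed
  define R where "R = max 0 ((h (\<lambda>_. 0) + (\<Sum>i<n. C i)) * K / e)"
  define S where "S = (\<Pi>\<^sub>E j\<in>UNIV. if j < d then {- R..R} else {0::real})"
  have cont: "continuous_on S h"
    unfolding h_def row_comb_def
    by (intro continuous_intros continuous_on_subset[OF continuous_on_product_coordinates]) auto
  have S0: "(\<lambda>_. 0) \<in> S" by (auto simp: S_def R_def PiE_iff)
  have "compact S" unfolding S_def by (rule compact_coordinate_box)
  then obtain y where y: "y \<in> S" "\<And>z. z \<in> S \<Longrightarrow> h y \<le> h z"
    using continuous_attains_inf[OF _ _ cont] S0 by blast
  \<comment> \<open>Outside the box, coercivity and the choice of \<open>R\<close> give \<open>h z \<ge> h 0 \<ge> h y\<close>.\<close>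
  have min: "h y \<le> h z" for z
  proof (cases "\<forall>j<d. \<bar>z j\<bar> \<le> R")
    case True
    define z' where "z' = (\<lambda>j. if j < d then z j else 0)"
    have "z' \<in> S" using True by (auto simp: S_def z'_def PiE_iff abs_le_iff)
    moreover have "h z' = h z" by (simp add: h_def row_comb_def z'_def)
    ultimately show ?thesis using y(2)[of z'] by simp
  next
    case False
    then obtain j where j: "j < d" "R < \<bar>z j\<bar>" by force
    have "(h (\<lambda>_. 0) + (\<Sum>i<n. C i)) * K / e \<le> \<bar>z j\<bar>" using j by (simp add: R_def)
    then have "h (\<lambda>_. 0) + (\<Sum>i<n. C i) \<le> e / K * \<bar>z j\<bar>"
      using e K by (simp add: field_simps)
    then have "h (\<lambda>_. 0) \<le> h z" using coer[OF j(1), of z] by linarith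
    then show ?thesis using y(2)[OF S0] by linarith
  qed
  show ?thesis
  proof (rule that[of y])
    fix j assume j: "j < d"
    let ?D = "\<Sum>i<n. a j i * (p i * exp (row_comb d a y i)) - a j i * x i"
    \<comment> \<open>The \<open>j\<close>-th equation is the vanishing of the \<open>j\<close>-th partial derivative of \<open>h\<close> at \<open>y\<close>.\<close>
    define g where "g = (\<lambda>t. h (y(j := y j + t)))"
    have g: "g t = (\<Sum>i<n. p i * exp (row_comb d a y i + t * a j i) - x i * (row_comb d a y i + t * a j i))" for t
      unfolding g_def h_def by (simp only: row_comb_update[OF j])
    have "(g has_field_derivative (\<Sum>i<n. p i * (exp (row_comb d a y i) * a j i) - x i * a j i)) (at 0)"
      unfolding g[abs_def] by (auto intro!: derivative_eq_intros simp: mult_ac)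
    moreover have "g 0 \<le> g t" for t using min by (simp add: g_def)
    ultimately have "(\<Sum>i<n. p i * (exp (row_comb d a y i) * a j i) - x i * a j i) = 0"
      using DERIV_local_min[of g _ 0 1] by auto
    then show "(\<Sum>i<n. a j i * (p i * exp (row_comb d a y i))) = (\<Sum>i<n. a j i * x i)"
      by (simp add: sum_subtractf mult_ac)
  qed
qed

text \<open>The vector \<open>ln m - ln m'\<close> is orthogonal to the rows of \<open>b\<close>, hence a combination of the rows of \<open>a\<close>,
  hence orthogonal to \<open>m - m'\<close>.  But every summand \<open>(m\<^sub>i - m'\<^sub>i) (ln m\<^sub>i - ln m'\<^sub>i)\<close> is nonnegative, and
  positive unless \<open>m\<^sub>i = m'\<^sub>i\<close>.\<close>

lemma positive_solution_unique:
  fixes m m' :: "nat \<Rightarrow> real"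
  assumes pos: "\<And>i. i < n \<Longrightarrow> 0 < m i" "\<And>i. i < n \<Longrightarrow> 0 < m' i"
    and lin: "\<And>j. j < d \<Longrightarrow> (\<Sum>i<n. a j i * m i) = (\<Sum>i<n. a j i * m' i)"
    and mon: "\<And>l. l < r \<Longrightarrow> (\<Sum>i<n. b l i * ln (m i)) = (\<Sum>i<n. b l i * ln (m' i))"
    and i: "i < n"
  shows "m i = m' i"
proof -
  interpret S: orthogonal_row_families b a r d n by (rule swap)
  obtain y where y: "\<And>i. i < n \<Longrightarrow> ln (m i) - ln (m' i) = row_comb d a y i"
  proof (rule S.orthogonal_to_a_imp_row_comb_b[of "\<lambda>i. ln (m i) - ln (m' i)"])
    show "(\<Sum>i<n. b l i * (ln (m i) - ln (m' i))) = 0" if "l < r" for l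
      using mon[OF that] by (simp add: right_diff_distrib sum_subtractf)
  qed (rule that)
  have "(\<Sum>i<n. (m i - m' i) * (ln (m i) - ln (m' i))) = (\<Sum>i<n. (m i - m' i) * row_comb d a y i)"
    using y by (intro sum.cong) auto
  also have "\<dots> = (\<Sum>j<d. y j * (\<Sum>i<n. a j i * (m i - m' i)))" by (rule sum_mult_row_comb)
  also have "\<dots> = 0" using lin by (simp add: right_diff_distrib sum_subtractf)
  finally have "(\<Sum>i<n. (m i - m' i) * (ln (m i) - ln (m' i))) = 0" .
  moreover have "0 \<le> (m i - m' i) * (ln (m i) - ln (m' i))" if "i < n" for i
    using pos[OF that] by (cases "m i \<le> m' i") (auto intro: mult_nonneg_nonneg mult_nonpos_nonpos)
  ultimately have "(m i - m' i) * (ln (m i) - ln (m' i)) = 0"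
    using i by (subst (asm) sum_nonneg_eq_0_iff) auto
  then show ?thesis using pos[OF i] by auto
qed

end

section \<open>Riemann sums over scaled lattices\<close>

lemma integrable_exp_neg_abs:
  fixes c :: real
  assumes c: "0 < c"
  shows "integrable lborel (\<lambda>x. exp (- c * \<bar>x\<bar>))"
proof -
  interpret prob_space "density lborel (exponential_density c)"
    by (rule prob_space_exponential_density[OF c])
  have nn: "0 \<le> exponential_density c x" for x using c by (rule exponential_density_nonneg)
  have "(\<integral>\<^sup>+x. ennreal (exponential_density c x) \<partial>lborel) = 1"
    using emeasure_space_1 by (simp add: emeasure_density)
  then have I: "integrable lborel (exponential_density c)"
    using nn by (intro integrableI_nonneg) auto
  \<comment> \<open>The integrand is at most the sum of an exponential density and its reflection, divided by \<open>c\<close>.\<close>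
  then have "integrable lborel (\<lambda>x. exponential_density c (0 + (-1) * x))"
    by (subst lborel_integrable_real_affine_iff) auto
  with I have "integrable lborel (\<lambda>x. (exponential_density c x + exponential_density c (0 + (-1) * x)) / c)"
    by (intro integrable_divide Bochner_Integration.integrable_add) auto
  then show ?thesis
  proof (rule Bochner_Integration.integrable_bound)
    show "AE x in lborel. norm (exp (- c * \<bar>x\<bar>)) \<le> norm ((exponential_density c x + exponential_density c (0 + (-1) * x)) / c)"
      using c by (intro AE_I2) (auto simp: exponential_density_def field_simps abs_if)
  qed simp
qed

lemma floor_box_iff:
  fixes c x v :: real
  assumes "0 < c"
  shows "\<lfloor>c * x - v\<rfloor> = z \<longleftrightarrow> x \<in> {(of_int z + v) / c ..< (of_int z + 1 + v) / c}"
  using assms by (auto simp: floor_eq_iff field_simps)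

text \<open>The lattice sum becomes an integral: the points that are rounded to \<open>z\<close> form a box with sides of
  length \<open>1 / c\<close>, and the boxes tile the space.\<close>

lemma has_bochner_integral_step_function:
  fixes F :: "(nat \<Rightarrow> int) \<Rightarrow> real" and c :: real and v :: "nat \<Rightarrow> real"
  assumes c: "0 < c" and Z: "finite Z" "Z \<subseteq> (\<Pi>\<^sub>E l\<in>{..<r}. UNIV)"
    and F: "\<And>z. z \<in> (\<Pi>\<^sub>E l\<in>{..<r}. UNIV) \<Longrightarrow> z \<notin> Z \<Longrightarrow> F z = 0"
  shows "has_bochner_integral (\<Pi>\<^sub>M l\<in>{..<r}. lborel)
    (\<lambda>s. F (\<lambda>l\<in>{..<r}. \<lfloor>c * s l - v l\<rfloor>)) ((\<Sum>z\<in>Z. F z) / c ^ r)"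
proof -
  interpret product_sigma_finite "\<lambda>_::nat. lborel :: real measure" ..
  let ?P = "\<Pi>\<^sub>M l\<in>{..<r}. (lborel :: real measure)"
  define box where "box = (\<lambda>z :: nat \<Rightarrow> int. \<Pi>\<^sub>E l\<in>{..<r}. {(of_int (z l) + v l) / c ..< (of_int (z l) + 1 + v l) / c})"
  have box: "emeasure ?P (box z) = ennreal ((1 / c) ^ r)" for z
  proof -
    have "emeasure ?P (box z) = (\<Prod>l<r. emeasure lborel {(of_int (z l) + v l) / c ..< (of_int (z l) + 1 + v l) / c})"
      unfolding box_def by (rule emeasure_PiM) auto
    also have "\<dots> = (\<Prod>l<r. ennreal (1 / c))"
    proof (rule prod.cong[OF refl])
      fix l
      have "(of_int (z l) + 1 + v l) / c - (of_int (z l) + v l) / c = 1 / c"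
        by (simp add: diff_divide_distrib[symmetric])
      moreover have "(of_int (z l) + v l) / c \<le> (of_int (z l) + 1 + v l) / c"
        using c by (intro divide_right_mono) auto
      ultimately show "emeasure lborel {(of_int (z l) + v l) / c ..< (of_int (z l) + 1 + v l) / c} = ennreal (1 / c)"
        by simp
    qed
    also have "\<dots> = ennreal ((1 / c) ^ r)" using c by (simp add: ennreal_power[symmetric])
    finally show ?thesis .
  qed
  have sets: "box z \<in> sets ?P" for z unfolding box_def by (intro sets_PiM_I_finite) auto
  have "has_bochner_integral ?P (\<lambda>s. \<Sum>z\<in>Z. indicator (box z) s *\<^sub>R F z) (\<Sum>z\<in>Z. measure ?P (box z) *\<^sub>R F z)"
    using sets box by (intro has_bochner_integral_sum has_bochner_integral_indicator) auto
  moreover have "(\<Sum>z\<in>Z. measure ?P (box z) *\<^sub>R F z) = (\<Sum>z\<in>Z. F z) / c ^ r"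
    using c by (simp add: measure_def box sum_divide_distrib power_divide)
  moreover have "(\<Sum>z\<in>Z. indicator (box z) s *\<^sub>R F z) = F (\<lambda>l\<in>{..<r}. \<lfloor>c * s l - v l\<rfloor>)"
    if s: "s \<in> space ?P" for s
  proof -
    let ?z = "\<lambda>l\<in>{..<r}. \<lfloor>c * s l - v l\<rfloor>"
    have z: "?z \<in> (\<Pi>\<^sub>E l\<in>{..<r}. UNIV)" by auto
    have iff: "s \<in> box z \<longleftrightarrow> z = ?z" if "z \<in> Z" for z
    proof -
      have zE: "z \<in> (\<Pi>\<^sub>E l\<in>{..<r}. UNIV)" using that Z by auto
      have "s \<in> box z \<longleftrightarrow> (\<forall>l<r. \<lfloor>c * s l - v l\<rfloor> = z l)"
        using s unfolding box_def floor_box_iff[OF c] by (auto simp: space_PiM PiE_iff)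
      also have "\<dots> \<longleftrightarrow> z = ?z"
        using zE z by (auto simp: PiE_iff intro!: extensionalityI[of _ "{..<r}"])
      finally show ?thesis .
    qed
    have "(\<Sum>z\<in>Z. indicator (box z) s *\<^sub>R F z) = (\<Sum>z\<in>Z. if z = ?z then F z else 0)"
      using iff by (intro sum.cong) (auto simp: indicator_def)
    also have "\<dots> = (if ?z \<in> Z then F ?z else 0)" using Z(1) by (simp add: sum.delta)
    also have "\<dots> = F ?z" using F[OF z] by auto
    finally show ?thesis .
  qed
  ultimately show ?thesis by (simp cong: has_bochner_integral_cong)
qed

text \<open>The entries of \<open>b M\<^sup>-\<^sup>1 b\<^sup>T\<close> with \<open>M = diag(m)\<close>.\<close>

definition gram_form :: "nat \<Rightarrow> (nat \<Rightarrow> nat \<Rightarrow> real) \<Rightarrow> (nat \<Rightarrow> real) \<Rightarrow> nat \<Rightarrow> nat \<Rightarrow> real" where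
  "gram_form n b m l l' = (\<Sum>i<n. b l i * b l' i / m i)"

lemma quad_form_gram_form:
  "quad_form r (gram_form n b m) s = (\<Sum>i<n. (row_comb r b s i)\<^sup>2 / m i)"
proof -
  have "(\<Sum>i<n. (row_comb r b s i)\<^sup>2 / m i) = (\<Sum>i<n. \<Sum>l<r. \<Sum>l'<r. b l i * b l' i / m i * s l * s l')"
    by (simp add: row_comb_def power2_eq_square sum_product sum_divide_distrib mult_ac)
  also have "\<dots> = (\<Sum>l<r. \<Sum>i<n. \<Sum>l'<r. b l i * b l' i / m i * s l * s l')"
    by (rule sum.swap)
  also have "\<dots> = (\<Sum>l<r. \<Sum>l'<r. \<Sum>i<n. b l i * b l' i / m i * s l * s l')"
    by (intro sum.cong refl sum.swap)
  finally show ?thesis by (simp add: quad_form_def gram_form_def sum_distrib_right)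
qed

text \<open>The affine lattices \<open>{k m + b\<^sup>T(z + k w) | z \<in> \<int>\<^sup>r}\<close>, seen from their centres \<open>k m\<close> on the scale \<open>sqrt k\<close>.
  Coercivity is injectivity of \<open>b\<^sup>T\<close> in quantitative form.\<close>

locale scaled_lattice_sum =
  fixes b :: "nat \<Rightarrow> nat \<Rightarrow> real" and r n :: nat and m w :: "nat \<Rightarrow> real" and C :: real
  assumes m_pos: "\<And>i. i < n \<Longrightarrow> 0 < m i"
    and C_pos: "0 < C"
    and coercive: "\<And>c l. l < r \<Longrightarrow> \<bar>c l\<bar> \<le> C * (\<Sum>i<n. \<bar>row_comb r b c i\<bar>)"
begin

definition point :: "nat \<Rightarrow> (nat \<Rightarrow> int) \<Rightarrow> nat \<Rightarrow> real" where
  "point k z i = real k * m i + row_comb r b (\<lambda>l. of_int (z l) + real k * w l) i"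

definition weight :: "nat \<Rightarrow> (nat \<Rightarrow> int) \<Rightarrow> real" where
  "weight k z = (\<Prod>i<n. poisson_ratio (real k * m i) (point k z i))"

text \<open>The integer vector whose box of side \<open>1 / sqrt k\<close> contains \<open>s\<close>.  Integer vectors of length \<open>r\<close> are
  represented by functions that are extensional on \<open>{..<r}\<close>, as in the product measure.\<close>

definition nearest :: "nat \<Rightarrow> (nat \<Rightarrow> real) \<Rightarrow> nat \<Rightarrow> int" where
  "nearest k s = (\<lambda>l\<in>{..<r}. \<lfloor>sqrt (real k) * s l - real k * w l\<rfloor>)"

lemma pos_def_gram_form: "pos_def_form r (gram_form n b m)"
  unfolding pos_def_form_def
proof (intro conjI allI impI)
  show "gram_form n b m l l' = gram_form n b m l' l" for l l' by (simp add: gram_form_def mult.commute)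
  fix s :: "nat \<Rightarrow> real" assume "\<exists>l<r. s l \<noteq> 0"
  then obtain l where l: "l < r" "s l \<noteq> 0" by blast
  have nn: "0 \<le> (row_comb r b s i)\<^sup>2 / m i" if "i < n" for i using m_pos[OF that] by simp
  have "(\<Sum>i<n. (row_comb r b s i)\<^sup>2 / m i) \<noteq> 0"
  proof
    assume "(\<Sum>i<n. (row_comb r b s i)\<^sup>2 / m i) = 0"
    then have "\<And>i. i < n \<Longrightarrow> (row_comb r b s i)\<^sup>2 / m i = 0"
      using nn by (subst (asm) sum_nonneg_eq_0_iff) auto
    then have "\<And>i. i < n \<Longrightarrow> row_comb r b s i = 0" using m_pos by force
    with coercive[OF l(1), of s] l(2) show False by simp
  qed
  moreover have "0 \<le> (\<Sum>i<n. (row_comb r b s i)\<^sup>2 / m i)" using nn by (intro sum_nonneg) auto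
  ultimately show "0 < quad_form r (gram_form n b m) s" by (simp add: quad_form_gram_form)
qed

text \<open>Rounding errors are at most \<open>1 / sqrt k\<close>, so for fixed \<open>s\<close> the rescaled lattice point
  \<open>(point k (nearest k s) - k m) / sqrt k\<close> tends to \<open>b\<^sup>T s\<close>.\<close>

lemma weight_nearest_tendsto:
  "(\<lambda>k. weight k (nearest k s)) \<longlonglongrightarrow> exp (- quad_form r (gram_form n b m) s / 2)"
proof -
  have inv: "(\<lambda>k. 1 / sqrt (real k)) \<longlonglongrightarrow> 0"
    by (intro tendsto_divide_0[OF tendsto_const] filterlim_at_top_imp_at_infinity
        filterlim_compose[OF sqrt_at_top filterlim_real_sequentially])
  have c: "(\<lambda>k. (of_int (nearest k s l) + real k * w l) / sqrt (real k)) \<longlonglongrightarrow> s l" if l: "l < r" for l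
  proof -
    have "(\<lambda>k. (of_int (nearest k s l) + real k * w l) / sqrt (real k) - s l) \<longlonglongrightarrow> 0"
    proof (rule Lim_null_comparison[OF _ inv])
      show "eventually (\<lambda>k. norm ((of_int (nearest k s l) + real k * w l) / sqrt (real k) - s l) \<le> 1 / sqrt (real k)) sequentially"
        using eventually_gt_at_top[of 0]
      proof eventually_elim
        case (elim k)
        let ?x = "sqrt (real k) * s l - real k * w l"
        have "(of_int (nearest k s l) + real k * w l) / sqrt (real k) - s l = (of_int \<lfloor>?x\<rfloor> - ?x) / sqrt (real k)"
          using elim l by (simp add: nearest_def field_simps)
        moreover have "\<bar>of_int \<lfloor>?x\<rfloor> - ?x\<bar> \<le> 1" by linarith
        ultimately show ?case using elim by (simp add: abs_divide divide_right_mono)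
      qed
    qed
    then show ?thesis by (simp add: LIM_zero_iff)
  qed
  have "(\<lambda>k. poisson_ratio (real k * m i) (point k (nearest k s) i)) \<longlonglongrightarrow> exp (- (row_comb r b s i)\<^sup>2 / (2 * m i))"
    if i: "i < n" for i
  proof (rule poisson_ratio_local_limit(1)[OF m_pos[OF i]])
    have "(point k (nearest k s) i - real k * m i) / sqrt (real k) =
      (\<Sum>l<r. b l i * ((of_int (nearest k s l) + real k * w l) / sqrt (real k)))" for k
      by (simp add: point_def row_comb_def sum_divide_distrib)
    moreover have "(\<lambda>k. \<Sum>l<r. b l i * ((of_int (nearest k s l) + real k * w l) / sqrt (real k))) \<longlonglongrightarrow> (\<Sum>l<r. b l i * s l)"
      using c by (intro tendsto_sum tendsto_mult tendsto_const) auto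
    ultimately show "(\<lambda>k. (point k (nearest k s) i - real k * m i) / sqrt (real k)) \<longlonglongrightarrow> row_comb r b s i"
      by (simp add: row_comb_def)
  qed
  then have "(\<lambda>k. weight k (nearest k s)) \<longlonglongrightarrow> (\<Prod>i<n. exp (- (row_comb r b s i)\<^sup>2 / (2 * m i)))"
    unfolding weight_def by (intro tendsto_prod) auto
  also have "(\<Prod>i<n. exp (- (row_comb r b s i)\<^sup>2 / (2 * m i))) = exp (- quad_form r (gram_form n b m) s / 2)"
    by (simp add: exp_sum[symmetric] quad_form_gram_form sum_negf[symmetric] sum_divide_distrib mult.commute)
  finally show ?thesis .
qed

text \<open>On the original scale rounding moves the point \<open>k m + sqrt k b\<^sup>T s\<close> by a bounded amount.  So the
  tail bound gives exponential decay in \<open>\<Sum>\<^sub>i \<bar>(b\<^sup>T s)\<^sub>i\<bar>\<close>, which coercivity turns into decay in \<open>s\<close>.\<close>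

lemma weight_nearest_dominated:
  assumes int: "\<And>k z i. i < n \<Longrightarrow> point k z i \<in> \<int>"
  obtains c K where "0 < c" "\<And>k s. 0 < k \<Longrightarrow> \<bar>weight k (nearest k s)\<bar> \<le> K * (\<Prod>l<r. exp (- c * \<bar>s l\<bar>))"
proof -
  define D where "D = (\<Sum>i<n. \<Sum>l<r. \<bar>b l i\<bar>)"
  define M where "M = 1 + (\<Sum>i<n. sqrt (m i))"
  \<comment> \<open>\<open>Suc r\<close> instead of \<open>r\<close> keeps the denominator positive when \<open>r = 0\<close>.\<close>
  define c where "c = 1 / (M * (C * real (Suc r)))"
  have "0 \<le> (\<Sum>i<n. sqrt (m i))" using m_pos by (intro sum_nonneg) (auto intro: less_imp_le)
  then have M1: "1 \<le> M" by (simp add: M_def)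
  have M: "sqrt (m i) + 1 \<le> M" if "i < n" for i
    using m_pos that member_le_sum[of i "{..<n}" "\<lambda>i. sqrt (m i)"] by (auto simp: M_def less_imp_le)
  have bd: "\<bar>weight k (nearest k s)\<bar> \<le> exp (real n * (3 + D)) * (\<Prod>l<r. exp (- c * \<bar>s l\<bar>))"
    if k: "0 < k" for k s
  proof -
    define t where "t = row_comb r b s"
    have k1: "1 \<le> sqrt (real k)" using k by simp
    have one: "poisson_ratio (real k * m i) (point k (nearest k s) i) \<le> exp (3 + D - \<bar>t i\<bar> / M)"
      if i: "i < n" for i
    proof (cases "0 \<le> point k (nearest k s) i")
      case True
      let ?x = "real k * m i" and ?u = "point k (nearest k s) i"
      have x: "0 < ?x" using k m_pos[OF i] by simp
      have "sqrt (real k) * t i - (?u - ?x) = (\<Sum>l<r. b l i * (sqrt (real k) * s l - (of_int (nearest k s l) + real k * w l)))"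
        by (simp add: t_def point_def row_comb_def sum_distrib_left right_diff_distrib sum_subtractf mult_ac)
      also have "\<bar>\<dots>\<bar> \<le> (\<Sum>l<r. \<bar>b l i\<bar>)"
      proof (rule order_trans[OF sum_abs sum_mono])
        fix l assume "l \<in> {..<r}"
        then have "\<bar>sqrt (real k) * s l - (of_int (nearest k s l) + real k * w l)\<bar> \<le> 1"
          unfolding nearest_def by (simp, linarith)
        then show "\<bar>b l i * (sqrt (real k) * s l - (of_int (nearest k s l) + real k * w l))\<bar> \<le> \<bar>b l i\<bar>"
          by (simp add: abs_mult mult_left_le)
      qed
      also have "\<dots> \<le> D" unfolding D_def
        using i by (intro member_le_sum[of i _ "\<lambda>i. \<Sum>l<r. \<bar>b l i\<bar>"]) (auto intro: sum_nonneg)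
      finally have diff: "sqrt (real k) * \<bar>t i\<bar> - D \<le> \<bar>?u - ?x\<bar>"
        using k1 abs_mult[of "sqrt (real k)" "t i"] by simp
      have D0: "0 \<le> D" by (auto simp: D_def intro!: sum_nonneg)
      have "sqrt ?x + 1 \<le> sqrt (real k) * (sqrt (m i) + 1)"
        using k1 by (simp add: real_sqrt_mult distrib_left)
      also have "\<dots> \<le> sqrt (real k) * M" using M[OF i] by (intro mult_left_mono) auto
      finally have den: "sqrt ?x + 1 \<le> sqrt (real k) * M" .
      have den1: "1 \<le> sqrt ?x + 1" "0 < sqrt ?x + 1" using x by (auto intro: add_nonneg_pos)
      have "\<bar>t i\<bar> / M = sqrt (real k) * \<bar>t i\<bar> / (sqrt (real k) * M)" using k by simp
      also have "\<dots> \<le> sqrt (real k) * \<bar>t i\<bar> / (sqrt ?x + 1)"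
        using den den1 k M1 by (intro divide_left_mono) (auto intro!: mult_pos_pos)
      also have "\<dots> \<le> (\<bar>?u - ?x\<bar> + D) / (sqrt ?x + 1)"
        using diff den1 by (intro divide_right_mono) auto
      also have "\<dots> = \<bar>?u - ?x\<bar> / (sqrt ?x + 1) + D / (sqrt ?x + 1)" by (rule add_divide_distrib)
      also have "D / (sqrt ?x + 1) \<le> D / 1" using D0 den1 by (intro divide_left_mono) auto
      finally have "3 - \<bar>?u - ?x\<bar> / (sqrt ?x + 1) \<le> 3 + D - \<bar>t i\<bar> / M" by simp
      then show ?thesis using poisson_ratio_tail[OF x True] by (meson exp_le_cancel_iff order_trans)
    next
      case False
      then show ?thesis using poisson_ratio_neg_int[OF int[OF i]] by simp
    qed
    have nn: "0 \<le> poisson_ratio (real k * m i) (point k (nearest k s) i)" if "i < n" for i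
      using poisson_ratio_nonneg int[OF that] m_pos[OF that] k by simp
    have "\<bar>weight k (nearest k s)\<bar> = weight k (nearest k s)"
      unfolding weight_def using nn by (intro abs_of_nonneg prod_nonneg) auto
    also have "\<dots> \<le> (\<Prod>i<n. exp (3 + D - \<bar>t i\<bar> / M))"
      unfolding weight_def using one nn by (intro prod_mono) auto
    also have "\<dots> = exp (real n * (3 + D)) * exp (- (\<Sum>i<n. \<bar>t i\<bar>) / M)"
      by (simp add: exp_sum[symmetric] sum_subtractf sum_divide_distrib[symmetric] exp_add[symmetric])
    also have "\<dots> \<le> exp (real n * (3 + D)) * exp (- c * (\<Sum>l<r. \<bar>s l\<bar>))"
    proof -
      have "(\<Sum>l<r. \<bar>s l\<bar>) \<le> (\<Sum>l<r. C * (\<Sum>i<n. \<bar>t i\<bar>))"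
        unfolding t_def by (intro sum_mono coercive) auto
      also have "\<dots> \<le> real (Suc r) * (C * (\<Sum>i<n. \<bar>t i\<bar>))"
        using C_pos by (auto simp: distrib_right intro!: mult_nonneg_nonneg sum_nonneg)
      finally have "c * (\<Sum>l<r. \<bar>s l\<bar>) \<le> c * (real (Suc r) * (C * (\<Sum>i<n. \<bar>t i\<bar>)))"
        using M1 C_pos by (intro mult_left_mono) (auto simp: c_def)
      also have "\<dots> = (\<Sum>i<n. \<bar>t i\<bar>) / M" using M1 C_pos by (simp add: c_def del: of_nat_Suc)
      finally show ?thesis by simp
    qed
    also have "exp (- c * (\<Sum>l<r. \<bar>s l\<bar>)) = (\<Prod>l<r. exp (- c * \<bar>s l\<bar>))"
      by (simp only: sum_distrib_left exp_sum finite_lessThan)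
    finally show ?thesis .
  qed
  have "0 < c" using M1 C_pos by (simp add: c_def)
  then show ?thesis using bd that by blast
qed

text \<open>The normalized sum is the integral of \<open>weight k (nearest k s)\<close> over \<open>s\<close>, whose integrand converges
  dominatedly to a Gaussian.\<close>

theorem weight_sum_asymptotics:
  assumes int: "\<And>k z i. i < n \<Longrightarrow> point k z i \<in> \<int>"
    and fin: "\<And>k. finite {z \<in> (\<Pi>\<^sub>E l\<in>{..<r}. UNIV). \<forall>i<n. 0 \<le> point k z i}" (is "\<And>k. finite (?Z k)")
  shows "(\<lambda>k. (\<Sum>z \<in> {z \<in> (\<Pi>\<^sub>E l\<in>{..<r}. UNIV). \<forall>i<n. 0 \<le> point k z i}. weight k z) / sqrt (real k) ^ r)
    \<longlonglongrightarrow> sqrt ((2 * pi) ^ r / Determinant.det (Matrix.mat r r (\<lambda>(l, l'). gram_form n b m l l')))"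
proof -
  let ?P = "\<Pi>\<^sub>M l\<in>{..<r}. (lborel :: real measure)"
  let ?q = "gram_form n b m"
  interpret product_sigma_finite "\<lambda>_::nat. lborel :: real measure" ..
  have hb: "has_bochner_integral ?P (\<lambda>s. weight k (nearest k s)) ((\<Sum>z\<in>?Z k. weight k z) / sqrt (real k) ^ r)"
    if "0 < k" for k
    unfolding nearest_def
  proof (rule has_bochner_integral_step_function[OF _ fin])
    fix z assume "z \<in> (\<Pi>\<^sub>E l\<in>{..<r}. UNIV)" "z \<notin> ?Z k"
    then obtain i where i: "i < n" "point k z i < 0" by force
    then have "poisson_ratio (real k * m i) (point k z i) = 0" using poisson_ratio_neg_int int by simp
    then show "weight k z = 0" unfolding weight_def using i by (intro prod_zero) auto
  qed (use that in auto)
  obtain c K where c: "0 < c" and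
    K: "\<And>k s. 0 < k \<Longrightarrow> \<bar>weight k (nearest k s)\<bar> \<le> K * (\<Prod>l<r. exp (- c * \<bar>s l\<bar>))"
    using weight_nearest_dominated[OF int] by blast
  \<comment> \<open>The shift to \<open>Suc k\<close> excludes \<open>k = 0\<close>, where the boxes have no finite size.\<close>
  have "(\<lambda>k. integral\<^sup>L ?P (\<lambda>s. weight (Suc k) (nearest (Suc k) s))) \<longlonglongrightarrow> integral\<^sup>L ?P (\<lambda>s. exp (- quad_form r ?q s / 2))"
  proof (rule integral_dominated_convergence[where w = "\<lambda>s. K * (\<Prod>l<r. exp (- c * \<bar>s l\<bar>))"])
    show "(\<lambda>s. weight (Suc k) (nearest (Suc k) s)) \<in> borel_measurable ?P" for k
      using hb[of "Suc k"] by (auto simp: has_bochner_integral_iff)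
    show "integrable ?P (\<lambda>s. K * (\<Prod>l<r. exp (- c * \<bar>s l\<bar>)))"
      by (intro integrable_mult_right product_integrable_prod integrable_exp_neg_abs c) simp
    show "AE s in ?P. (\<lambda>k. weight (Suc k) (nearest (Suc k) s)) \<longlonglongrightarrow> exp (- quad_form r ?q s / 2)"
      using weight_nearest_tendsto by (intro AE_I2 LIMSEQ_Suc)
    show "AE s in ?P. norm (weight (Suc k) (nearest (Suc k) s)) \<le> K * (\<Prod>l<r. exp (- c * \<bar>s l\<bar>))" for k
      using K by (intro AE_I2) auto
  qed measurable
  also have "(\<lambda>k. integral\<^sup>L ?P (\<lambda>s. weight (Suc k) (nearest (Suc k) s))) =
    (\<lambda>k. (\<Sum>z\<in>?Z (Suc k). weight (Suc k) z) / sqrt (real (Suc k)) ^ r)"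
    by (intro ext has_bochner_integral_integral_eq hb) simp
  also have "integral\<^sup>L ?P (\<lambda>s. exp (- quad_form r ?q s / 2)) =
      sqrt ((2 * pi) ^ r / Determinant.det (Matrix.mat r r (\<lambda>(l, l'). ?q l l')))"
    using gaussian_integral_quad_form[OF pos_def_gram_form]
    by (subst integral_eq_nn_integral) (auto simp: enn2real_ennreal)
  finally show ?thesis by (rule LIMSEQ_imp_Suc)
qed

end

section \<open>Asymptotics of hypergeometric polynomials\<close>

locale hypergeometric_setup =
  fixes d n :: nat and A :: "nat mat" and B :: "int mat"
    and \<beta> :: "nat Matrix.vec" and p :: "real Matrix.vec"
  assumes A: "A \<in> carrier_mat d n"
    and rank: "vec_space.rank d (map_mat real A) = d"
    and config: "configuration_matrix A"
    and gale: "gale_transform A B"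
    and \<beta>_monoid: "\<beta> \<in> monoid_span A"
    and \<beta>_interior: "map_vec real \<beta> \<in> vec_topology d interior_of (cone_span A)"
    and p: "p \<in> pos_vec n"
begin

abbreviation a :: "nat \<Rightarrow> nat \<Rightarrow> real" where "a j i \<equiv> real (A $$ (j, i))"

abbreviation b :: "nat \<Rightarrow> nat \<Rightarrow> real" where "b l i \<equiv> real_of_int (B $$ (l, i))"

lemma B: "B \<in> carrier_mat (n - d) n"
  using gale A by (auto simp: gale_transform_def)

lemma d_le_n: "d \<le> n"
proof -
  have "vec_space.rank d (map_mat real A) \<le> n"
    using A by (intro vec_space.rank_le_nc) auto
  then show ?thesis by (simp add: rank)
qed

lemma real_mult_vec_nth:
  assumes "x \<in> carrier_vec n" "j < d"
  shows "(map_mat real A *\<^sub>v x) $ j = (\<Sum>i<n. a j i * x $ i)"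
  using assms A by (auto simp: scalar_prod_def lessThan_atLeast0)

lemma nat_mult_vec_nth:
  assumes "u \<in> carrier_vec n" "j < d"
  shows "real ((A *\<^sub>v u) $ j) = (\<Sum>i<n. a j i * real (u $ i))"
  using assms A by (auto simp: scalar_prod_def lessThan_atLeast0)

lemma int_mult_vec_nth:
  assumes "x \<in> carrier_vec n" "j < d"
  shows "real_of_int ((map_mat int A *\<^sub>v x) $ j) = (\<Sum>i<n. a j i * real_of_int (x $ i))"
  using assms A by (auto simp: scalar_prod_def lessThan_atLeast0)

lemma int_row_comb:
  assumes "c \<in> carrier_vec (n - d)" "i < n"
  shows "(transpose_mat B *\<^sub>v c) $ i = (\<Sum>l<n - d. B $$ (l, i) * c $ l)"
  using assms B by (auto simp: scalar_prod_def lessThan_atLeast0)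

lemma rows_orthogonal:
  assumes "j < d" "l < n - d"
  shows "(\<Sum>i<n. a j i * b l i) = 0"
proof -
  have ker: "Matrix.row B l \<in> mat_kernel (map_mat int A)"
    using gale assms B by (auto simp: gale_transform_def)
  have c: "Matrix.row B l \<in> carrier_vec n" using carrier_matD[OF B] by (intro carrier_vecI) simp
  have "map_mat int A *\<^sub>v Matrix.row B l = 0\<^sub>v d"
    using ker A by (auto simp: mat_kernel_def)
  then have "real_of_int ((map_mat int A *\<^sub>v Matrix.row B l) $ j) = 0" using assms(1) by simp
  then show ?thesis using assms B unfolding int_mult_vec_nth[OF c assms(1)] by simp
qed

lemma gale_rows_independent:
  assumes "\<And>i. i < n \<Longrightarrow> row_comb (n - d) b c i = 0" "l < n - d"
  shows "c l = 0"
proof (rule int_independent_imp_real_independent[OF _ assms])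
  fix c :: "nat \<Rightarrow> int" and l
  assume c: "\<And>i. i < n \<Longrightarrow> (\<Sum>l<n - d. B $$ (l, i) * c l) = 0" and l: "l < n - d"
  have "transpose_mat B *\<^sub>v Matrix.vec (n - d) c = 0\<^sub>v n"
  proof (rule eq_vecI)
    fix i assume "i < dim_vec (0\<^sub>v n :: int Matrix.vec)"
    then show "(transpose_mat B *\<^sub>v Matrix.vec (n - d) c) $ i = 0\<^sub>v n $ i"
      using c by (subst int_row_comb) auto
  qed (use B in auto)
  then have "Matrix.vec (n - d) c = 0\<^sub>v (n - d)"
    using gale B by (auto simp: gale_transform_def)
  then show "c l = 0" using l by (metis index_vec index_zero_vec(1))
qed

lemma \<beta>_eq:
  obtains u where "u \<in> carrier_vec n" "\<beta> = A *\<^sub>v u"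
  using \<beta>_monoid A by (auto simp: monoid_span_def)

lemma \<beta>_carrier: "\<beta> \<in> carrier_vec d"
  by (rule \<beta>_eq) (use A in auto)

lemma cone_span_nth:
  assumes "y \<in> cone_span A"
  obtains c where "\<And>i. i < n \<Longrightarrow> 0 \<le> c i" "\<And>j. j < d \<Longrightarrow> y $ j = (\<Sum>i<n. a j i * c i)"
proof -
  obtain c where c: "c \<in> carrier_vec n" "\<forall>i<n. 0 \<le> c $ i" "y = map_mat real A *\<^sub>v c"
    using assms A by (auto simp: cone_span_def)
  then show ?thesis using that[of "\<lambda>i. c $ i"] real_mult_vec_nth by auto
qed

lemma interior_box:
  obtains e where "0 < e" "\<forall>y. (\<forall>j<d. \<bar>y j - real (\<beta> $ j)\<bar> < e) \<longrightarrow>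
    (\<exists>c. (\<forall>i<n. 0 \<le> c i) \<and> (\<forall>j<d. y j = (\<Sum>i<n. a j i * c i)))"
proof -
  have "map_vec real \<beta> \<in> carrier_vec d" using \<beta>_carrier by simp
  from \<beta>_interior[unfolded interior_of_vec_topology_iff[OF this]] obtain e where e: "0 < e"
    "\<And>y. y \<in> carrier_vec d \<Longrightarrow> \<forall>j<d. \<bar>y $ j - map_vec real \<beta> $ j\<bar> < e \<Longrightarrow> y \<in> cone_span A"
    by blast
  show ?thesis
  proof (rule that[OF e(1)], intro allI impI)
    fix y :: "nat \<Rightarrow> real" assume y: "\<forall>j<d. \<bar>y j - real (\<beta> $ j)\<bar> < e"
    have "Matrix.vec d y \<in> cone_span A" using y \<beta>_carrier by (intro e(2)) auto
    then obtain c where "\<And>i. i < n \<Longrightarrow> 0 \<le> c i" "\<And>j. j < d \<Longrightarrow> Matrix.vec d y $ j = (\<Sum>i<n. a j i * c i)"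
      by (rule cone_span_nth) (rule that)
    then show "\<exists>c. (\<forall>i<n. 0 \<le> c i) \<and> (\<forall>j<d. y j = (\<Sum>i<n. a j i * c i))" by auto
  qed
qed

text \<open>For small \<open>t > 0\<close> the vector \<open>\<beta> + t y\<close> still lies in the cone, hence like \<open>\<beta>\<close> in the column space of \<open>A\<close>.
  This space is orthogonal to \<open>y\<close> when \<open>A\<^sup>T y = 0\<close>, so \<open>t \<bar>y\<bar>\<^sup>2 = 0\<close>.\<close>

lemma matrix_rows_independent:
  assumes y: "\<And>i. i < n \<Longrightarrow> row_comb d a y i = 0" and j: "j < d"
  shows "y j = 0"
proof -
  obtain e where e: "0 < e" "\<forall>z. (\<forall>j<d. \<bar>z j - real (\<beta> $ j)\<bar> < e) \<longrightarrow>
    (\<exists>c. (\<forall>i<n. 0 \<le> c i) \<and> (\<forall>j<d. z j = (\<Sum>i<n. a j i * c i)))"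
    by (rule interior_box)
  obtain u where u: "u \<in> carrier_vec n" "\<beta> = A *\<^sub>v u" by (rule \<beta>_eq)
  have \<beta>: "real (\<beta> $ j) = (\<Sum>i<n. a j i * real (u $ i))" if "j < d" for j
    unfolding u(2) by (rule nat_mult_vec_nth[OF u(1) that])
  define S where "S = 1 + (\<Sum>j<d. \<bar>y j\<bar>)"
  define t where "t = e / S"
  have S: "0 < S" "\<bar>y j\<bar> < S" if "j < d" for j
    using member_le_sum[of j "{..<d}" "\<lambda>j. \<bar>y j\<bar>"] that
    by (auto simp: S_def intro!: add_pos_nonneg sum_nonneg)
  have t: "0 < t" using S(1)[OF j] e(1) by (simp add: t_def)
  obtain c where c: "\<And>j. j < d \<Longrightarrow> real (\<beta> $ j) + t * y j = (\<Sum>i<n. a j i * c i)"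
  proof -
    have "\<bar>t * y k\<bar> < e" if "k < d" for k
    proof -
      have "\<bar>t * y k\<bar> = t * \<bar>y k\<bar>" using t by (simp add: abs_mult)
      also have "\<dots> < t * S" using S(2)[OF that] t by (intro mult_strict_left_mono) auto
      also have "\<dots> = e" using S(1)[OF that] by (simp add: t_def)
      finally show ?thesis .
    qed
    then show ?thesis using e(2)[rule_format, of "\<lambda>j. real (\<beta> $ j) + t * y j"] that by auto
  qed
  have "t * y j = (\<Sum>i<n. a j i * (c i - real (u $ i)))" if "j < d" for j
    using c[OF that] \<beta>[OF that] by (simp add: right_diff_distrib sum_subtractf)
  then have "(\<Sum>j<d. y j * (t * y j)) = (\<Sum>j<d. y j * (\<Sum>i<n. a j i * (c i - real (u $ i))))"
    by simp
  also have "\<dots> = (\<Sum>i<n. (c i - real (u $ i)) * row_comb d a y i)"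
    by (rule sum_mult_row_comb[symmetric])
  also have "\<dots> = 0" using y by simp
  finally have "(\<Sum>j<d. y j * (t * y j)) = 0" .
  then have "y j * (t * y j) = 0"
    using t j by (subst (asm) sum_nonneg_eq_0_iff) (auto simp: mult.left_commute[of _ t])
  then show ?thesis using t by simp
qed

sublocale orthogonal_row_families a b d "n - d" n
  by unfold_locales (fact rows_orthogonal | fact matrix_rows_independent
      | fact gale_rows_independent | simp add: d_le_n)+

text \<open>Subtracting from \<open>\<beta>\<close> a small multiple \<open>t\<close> of the sum of all columns stays inside the cone; adding \<open>t\<close> to each
  coefficient of the resulting combination gives one for \<open>\<beta>\<close> with coefficients at least \<open>t\<close>.\<close>

lemma \<beta>_interior_solution:
  obtains e x where "0 < e" "\<And>i. i < n \<Longrightarrow> e \<le> x i"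
    "\<And>j. j < d \<Longrightarrow> (\<Sum>i<n. a j i * x i) = real (\<beta> $ j)"
proof -
  obtain e where e: "0 < e" "\<forall>y. (\<forall>j<d. \<bar>y j - real (\<beta> $ j)\<bar> < e) \<longrightarrow>
    (\<exists>c. (\<forall>i<n. 0 \<le> c i) \<and> (\<forall>j<d. y j = (\<Sum>i<n. a j i * c i)))"
    by (rule interior_box)
  define S where "S = 1 + (\<Sum>j<d. \<Sum>i<n. a j i)"
  define t where "t = e / S"
  have S_pos: "0 < S" by (auto simp: S_def intro!: add_pos_nonneg sum_nonneg)
  have S: "(\<Sum>i<n. a j i) < S" if "j < d" for j
    using member_le_sum[of j "{..<d}" "\<lambda>j. \<Sum>i<n. a j i"] that by (auto simp: S_def sum_nonneg)
  have t: "0 < t" using S_pos e(1) by (simp add: t_def)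
  have "\<bar>t * (\<Sum>i<n. a j i)\<bar> < e" if "j < d" for j
  proof -
    have "\<bar>t * (\<Sum>i<n. a j i)\<bar> = t * (\<Sum>i<n. a j i)"
      using t by (intro abs_of_nonneg mult_nonneg_nonneg sum_nonneg) auto
    also have "\<dots> < t * S" using S[OF that] t by (intro mult_strict_left_mono) auto
    also have "\<dots> = e" using S_pos by (simp add: t_def)
    finally show ?thesis .
  qed
  then obtain c where c: "\<forall>i<n. 0 \<le> c i" "\<forall>j<d. real (\<beta> $ j) - t * (\<Sum>i<n. a j i) = (\<Sum>i<n. a j i * c i)"
    using e(2)[rule_format, of "\<lambda>j. real (\<beta> $ j) - t * (\<Sum>i<n. a j i)"] by auto
  show ?thesis
  proof (rule that[of t "\<lambda>i. c i + t"])
    show "(\<Sum>i<n. a j i * (c i + t)) = real (\<beta> $ j)" if "j < d" for j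
    proof -
      have "(\<Sum>i<n. a j i * (c i + t)) = (\<Sum>i<n. a j i * c i) + t * (\<Sum>i<n. a j i)"
        by (simp add: distrib_left sum.distrib sum_distrib_left mult.commute[of t])
      with c(2)[rule_format, OF that] show ?thesis by linarith
    qed
  qed (use c t in auto)
qed

definition solution :: "real Matrix.vec \<Rightarrow> bool" where
  "solution m \<longleftrightarrow> m \<in> pos_vec n \<and> map_mat real A *\<^sub>v m = map_vec real \<beta> \<and>
     (\<forall>i < n - d. int_monomial m (Matrix.row B i) = int_monomial p (Matrix.row B i))"

lemma int_monomial_eq_exp:
  assumes "x \<in> pos_vec n" "l < n - d"
  shows "int_monomial x (Matrix.row B l) = exp (\<Sum>i<n. b l i * ln (x $ i))"
proof -
  have "int_monomial x (Matrix.row B l) = (\<Prod>i<n. x $ i powi B $$ (l, i))"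
    using assms B by (simp add: int_monomial_def)
  also have "\<dots> = (\<Prod>i<n. exp (b l i * ln (x $ i)))"
  proof (rule prod.cong[OF refl])
    fix i assume "i \<in> {..<n}"
    then have "0 < x $ i" using assms by (auto simp: pos_vec_def)
    then show "x $ i powi B $$ (l, i) = exp (b l i * ln (x $ i))"
      using powr_real_of_int'[of "x $ i" "B $$ (l, i)"] by (simp add: powr_def)
  qed
  finally show ?thesis by (simp add: exp_sum)
qed

text \<open>Taking logarithms makes the monomial equations linear.\<close>

lemma solution_iff:
  "solution m \<longleftrightarrow> m \<in> pos_vec n \<and> (\<forall>j<d. (\<Sum>i<n. a j i * m $ i) = real (\<beta> $ j)) \<and>
     (\<forall>l<n - d. (\<Sum>i<n. b l i * ln (m $ i)) = (\<Sum>i<n. b l i * ln (p $ i)))"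
proof (cases "m \<in> pos_vec n")
  case True
  then have m: "m \<in> carrier_vec n" by (simp add: pos_vec_def)
  have "map_mat real A *\<^sub>v m = map_vec real \<beta> \<longleftrightarrow>
      (\<forall>j<d. (map_mat real A *\<^sub>v m) $ j = map_vec real \<beta> $ j)"
    using A \<beta>_carrier by (auto simp: vec_eq_iff)
  then show ?thesis
    using True \<beta>_carrier m by (auto simp: solution_def int_monomial_eq_exp p real_mult_vec_nth simp del: index_mult_mat_vec)
qed (simp add: solution_def)

text \<open>Multiplying \<open>p\<^sub>i\<close> by \<open>exp ((A\<^sup>T y)\<^sub>i)\<close> changes no monomial with exponent in the kernel of \<open>A\<close>.\<close>

lemma solution_exists_unique: "\<exists>!m. solution m"
proof -
  have p_pos: "0 < p $ i" if "i < n" for i using p that by (simp add: pos_vec_def)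
  obtain e x where e: "0 < e" "\<And>i. i < n \<Longrightarrow> e \<le> x i"
    "\<And>j. j < d \<Longrightarrow> (\<Sum>i<n. a j i * x i) = real (\<beta> $ j)"
    by (rule \<beta>_interior_solution) (rule that)
  obtain y where y: "\<And>j. j < d \<Longrightarrow>
    (\<Sum>i<n. a j i * (p $ i * exp (row_comb d a y i))) = (\<Sum>i<n. a j i * x i)"
    by (rule positive_solution_exists[of "\<lambda>i. p $ i", OF p_pos e(1,2)]) (auto intro: that)
  define m where "m = Matrix.vec n (\<lambda>i. p $ i * exp (row_comb d a y i))"
  have "solution m"
    unfolding solution_iff
  proof (intro conjI allI impI)
    show "m \<in> pos_vec n" using p_pos by (simp add: pos_vec_def m_def)
    show "(\<Sum>i<n. a j i * m $ i) = real (\<beta> $ j)" if "j < d" for j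
      using y[OF that] e(3)[OF that] by (simp add: m_def)
    fix l assume l: "l < n - d"
    have "(\<Sum>i<n. b l i * ln (m $ i)) = (\<Sum>i<n. b l i * ln (p $ i)) + (\<Sum>i<n. b l i * row_comb d a y i)"
      unfolding sum.distrib[symmetric]
    proof (rule sum.cong[OF refl])
      fix i assume "i \<in> {..<n}"
      then show "b l i * ln (m $ i) = b l i * ln (p $ i) + b l i * row_comb d a y i"
        using p_pos[of i] by (simp add: m_def ln_mult_pos distrib_left)
    qed
    also have "(\<Sum>i<n. b l i * row_comb d a y i) = 0"
      using l rows_orthogonal by (simp add: sum_mult_row_comb)
    finally show "(\<Sum>i<n. b l i * ln (m $ i)) = (\<Sum>i<n. b l i * ln (p $ i))" by simp
  qed
  moreover have "m1 = m2" if s: "solution m1" "solution m2" for m1 m2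
  proof (rule eq_vecI)
    have c: "m1 \<in> carrier_vec n" "m2 \<in> carrier_vec n"
      using s by (auto simp: solution_iff pos_vec_def)
    then show "dim_vec m1 = dim_vec m2" by simp
    fix i assume "i < dim_vec m2"
    with c have "i < n" by simp
    then show "m1 $ i = m2 $ i"
      by (rule positive_solution_unique[of "\<lambda>i. m1 $ i" "\<lambda>i. m2 $ i", rotated -1])
        (use s in \<open>auto simp: solution_iff pos_vec_def\<close>)
  qed
  ultimately show ?thesis by blast
qed

lemma gram_matrix_eq:
  assumes "m \<in> carrier_vec n"
  shows "map_mat real_of_int B * mat_diag n (\<lambda>i. inverse (m $ i)) * transpose_mat (map_mat real_of_int B)
    = Matrix.mat (n - d) (n - d) (\<lambda>(l, l'). gram_form n b (\<lambda>i. m $ i) l l')"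
proof -
  have R: "map_mat real_of_int B \<in> carrier_mat (n - d) n" using B by simp
  show ?thesis
    unfolding mat_diag_mult_right[OF R]
    by (rule eq_matI)
      (use B in \<open>auto simp: scalar_prod_def gram_form_def lessThan_atLeast0 divide_inverse intro!: sum.cong\<close>)
qed

text \<open>With \<open>\<beta> = A u\<close> and \<open>u - m = B\<^sup>T w\<close>, the fibre over \<open>k \<beta>\<close> consists of the vectors
  \<open>k u + B\<^sup>T z = k m + B\<^sup>T(z + k w)\<close> that have no negative entry.  Dividing its terms by
  \<open>\<Prod>\<^sub>i p\<^sub>i powr (k m\<^sub>i) / \<Gamma>(k m\<^sub>i + 1)\<close> gives the weights of \<open>scaled_lattice_sum\<close>.\<close>

lemma solution_asymptotics:
  assumes "solution m"
  shows "(\<lambda>k::nat. hypergeometric_poly A (k \<cdot>\<^sub>v \<beta>) p /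
              ((\<Prod>i<n. p $ i powr (m $ i)) ^ k / (\<Prod>i<n. Gamma (real k * m $ i + 1)) *
               ((2 * pi * real k) powr (real (n - d) / 2) /
                sqrt (Determinant.det (map_mat real_of_int B * mat_diag n (\<lambda>i. inverse (m $ i)) *
                           transpose_mat (map_mat real_of_int B))))))
           \<longlonglongrightarrow> 1"
proof -
  let ?r = "n - d"
  define \<mu> where "\<mu> = (\<lambda>i. m $ i)"
  have mc: "m \<in> carrier_vec n" and m_pos: "\<And>i. i < n \<Longrightarrow> 0 < \<mu> i"
    and lin: "\<And>j. j < d \<Longrightarrow> (\<Sum>i<n. a j i * \<mu> i) = real (\<beta> $ j)"
    and mon: "\<And>l. l < ?r \<Longrightarrow> (\<Sum>i<n. b l i * ln (\<mu> i)) = (\<Sum>i<n. b l i * ln (p $ i))"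
    using assms by (auto simp: solution_iff pos_vec_def \<mu>_def)
  have p_pos: "0 < p $ i" if "i < n" for i using p that by (simp add: pos_vec_def)
  have nz: "\<mu> i \<noteq> 0" "p $ i \<noteq> 0" if "i < n" for i
    using m_pos[OF that] p_pos[OF that] by auto
  have Gamma_nz: "Gamma (real k * \<mu> i + 1) \<noteq> 0" if "i < n" for i and k :: nat
  proof -
    have "0 < real k * \<mu> i + 1"
      using m_pos[OF that] by (intro add_nonneg_pos mult_nonneg_nonneg) auto
    from Gamma_real_pos[OF this] show ?thesis by simp
  qed
  obtain u where u: "u \<in> carrier_vec n" "\<beta> = A *\<^sub>v u" by (rule \<beta>_eq)
  have \<beta>u: "real (\<beta> $ j) = (\<Sum>i<n. a j i * real (u $ i))" if "j < d" for j
    unfolding u(2) by (rule nat_mult_vec_nth[OF u(1) that])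
  obtain w where w: "\<And>i. i < n \<Longrightarrow> real (u $ i) - \<mu> i = row_comb ?r b w i"
  proof (rule orthogonal_to_a_imp_row_comb_b[of "\<lambda>i. real (u $ i) - \<mu> i"])
    show "(\<Sum>i<n. a j i * (real (u $ i) - \<mu> i)) = 0" if "j < d" for j
      using lin[OF that] \<beta>u[OF that] by (simp add: right_diff_distrib sum_subtractf)
  qed (rule that)
  interpret S: orthogonal_row_families b a ?r d n by (rule swap)
  obtain C where C: "0 < C" "\<And>c l. l < ?r \<Longrightarrow> \<bar>c l\<bar> \<le> C * (\<Sum>i<n. \<bar>row_comb ?r b c i\<bar>)"
    by (rule S.row_comb_coercive) (rule that)
  interpret L: scaled_lattice_sum b ?r n \<mu> w C
    by unfold_locales (use m_pos C in auto)
  define coord where "coord = (\<lambda>k z i. int k * int (u $ i) + (\<Sum>l<?r. B $$ (l, i) * z l))"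
  have point: "L.point k z i = real_of_int (coord k z i)" if "i < n" for k z i
  proof -
    have "row_comb ?r b (\<lambda>l. of_int (z l) + real k * w l) i = row_comb ?r b (\<lambda>l. of_int (z l)) i + real k * row_comb ?r b w i"
      by (simp add: row_comb_def distrib_left sum.distrib sum_distrib_left mult_ac)
    moreover have "real k * real (u $ i) = real k * \<mu> i + real k * row_comb ?r b w i"
      by (simp add: w[OF that, symmetric] right_diff_distrib)
    ultimately show ?thesis
      by (simp add: L.point_def coord_def) (simp add: row_comb_def)
  qed
  have point_diff: "L.point k z i - real k * \<mu> i = row_comb ?r b (\<lambda>l. of_int (z l) + real k * w l) i" for k z i
    by (simp add: L.point_def)
  have int: "L.point k z i \<in> \<int>" if "i < n" for k z i using point[OF that] by simp
  define Z where "Z = (\<lambda>k. {z \<in> (\<Pi>\<^sub>E l\<in>{..<?r}. UNIV). \<forall>i<n. 0 \<le> L.point k z i})"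
  define f where "f = (\<lambda>k z. Matrix.vec n (\<lambda>i. nat (coord k z i)))"
  have f_nth: "real (f k z $ i) = L.point k z i" if "z \<in> Z k" "i < n" for k z i
    using that by (simp add: Z_def f_def point)
  \<comment> \<open>The rows of \<open>B\<close> generate the integer kernel of \<open>A\<close> and are independent.\<close>
  have bij: "bij_betw (f k) (Z k) (fiber A (k \<cdot>\<^sub>v \<beta>))" for k
    unfolding bij_betw_def
  proof
    show "inj_on (f k) (Z k)"
    proof (rule inj_onI)
      fix z z' assume z: "z \<in> Z k" "z' \<in> Z k" "f k z = f k z'"
      have "row_comb ?r b (\<lambda>l. of_int (z l) - of_int (z' l)) i = 0" if "i < n" for i
      proof -
        have "L.point k z i = L.point k z' i" using f_nth[OF z(1) that] f_nth[OF z(2) that] z(3) by simp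
        then show ?thesis by (simp add: L.point_def row_comb_def algebra_simps sum_subtractf sum.distrib)
      qed
      from gale_rows_independent[OF this] have "z l = z' l" if "l < ?r" for l using that by force
      then show "z = z'" using z by (intro extensionalityI[of _ "{..<?r}"]) (auto simp: Z_def PiE_iff)
    qed
    show "f k ` Z k = fiber A (k \<cdot>\<^sub>v \<beta>)"
    proof (intro equalityI subsetI)
      fix v assume "v \<in> f k ` Z k"
      then obtain z where z: "z \<in> Z k" "v = f k z" by blast
      have vc: "v \<in> carrier_vec n" by (simp add: z(2) f_def)
      have "A *\<^sub>v v = k \<cdot>\<^sub>v \<beta>"
      proof (rule eq_vecI)
        fix j assume "j < dim_vec (k \<cdot>\<^sub>v \<beta>)"
        then have j: "j < d" using \<beta>_carrier by simp
        let ?g = "row_comb ?r b (\<lambda>l. of_int (z l) + real k * w l)"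
        have "real ((A *\<^sub>v v) $ j) = (\<Sum>i<n. a j i * L.point k z i)"
          unfolding nat_mult_vec_nth[OF vc j] using f_nth[OF z(1)] by (simp add: z(2))
        also have "\<dots> = real k * (\<Sum>i<n. a j i * \<mu> i) + (\<Sum>i<n. a j i * ?g i)"
          by (simp add: L.point_def distrib_left sum.distrib sum_distrib_left mult_ac)
        also have "(\<Sum>i<n. a j i * ?g i) = 0"
          using rows_orthogonal[OF j] by (simp add: sum_mult_row_comb mult.commute)
        finally have "real ((A *\<^sub>v v) $ j) = real (k * \<beta> $ j)" using lin[OF j] by simp
        then show "(A *\<^sub>v v) $ j = (k \<cdot>\<^sub>v \<beta>) $ j" using j \<beta>_carrier by (simp only: of_nat_eq_iff) simp
      qed (use A \<beta>_carrier in auto)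
      then show "v \<in> fiber A (k \<cdot>\<^sub>v \<beta>)" using vc A by (simp add: fiber_def)
    next
      fix v assume v: "v \<in> fiber A (k \<cdot>\<^sub>v \<beta>)"
      then have vc: "v \<in> carrier_vec n" and Av: "A *\<^sub>v v = k \<cdot>\<^sub>v \<beta>" using A by (auto simp: fiber_def)
      let ?x = "Matrix.vec n (\<lambda>i. int (v $ i) - int k * int (u $ i))"
      have "map_mat int A *\<^sub>v ?x = 0\<^sub>v d"
      proof (rule eq_vecI)
        fix j assume "j < dim_vec (0\<^sub>v d :: int Matrix.vec)"
        then have j: "j < d" by simp
        have "real_of_int ((map_mat int A *\<^sub>v ?x) $ j) = (\<Sum>i<n. a j i * real (v $ i)) - real k * (\<Sum>i<n. a j i * real (u $ i))"
          by (subst int_mult_vec_nth[OF _ j]) (simp_all add: right_diff_distrib sum_subtractf sum_distrib_left mult_ac)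
        also have "\<dots> = real ((A *\<^sub>v v) $ j) - real k * real (\<beta> $ j)"
          using nat_mult_vec_nth[OF vc j] \<beta>u[OF j] by simp
        also have "\<dots> = 0" using j \<beta>_carrier by (simp add: Av)
        finally show "(map_mat int A *\<^sub>v ?x) $ j = 0\<^sub>v d $ j" using j by simp
      qed (use A in auto)
      then have "?x \<in> mat_kernel (map_mat int A)" using A by (simp add: mat_kernel_def)
      then obtain c where c: "c \<in> carrier_vec ?r" "?x = transpose_mat B *\<^sub>v c"
        using gale B by (auto simp: gale_transform_def)
      define z where "z = (\<lambda>l\<in>{..<?r}. c $ l)"
      have coord: "coord k z i = int (v $ i)" if "i < n" for i
      proof -
        have "int (v $ i) - int k * int (u $ i) = (transpose_mat B *\<^sub>v c) $ i"
          using that by (simp add: c(2)[symmetric])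
        also have "\<dots> = (\<Sum>l<?r. B $$ (l, i) * c $ l)" by (rule int_row_comb[OF c(1) that])
        also have "\<dots> = (\<Sum>l<?r. B $$ (l, i) * z l)" by (simp add: z_def)
        finally show ?thesis by (simp add: coord_def)
      qed
      have "z \<in> (\<Pi>\<^sub>E l\<in>{..<?r}. UNIV)" unfolding z_def by simp
      then have "z \<in> Z k" by (simp add: Z_def point coord)
      moreover have "v = f k z" using vc by (auto simp: f_def coord)
      ultimately show "v \<in> f k ` Z k" by blast
    qed
  qed
  have fin: "finite (Z k)" for k using bij_betw_finite[OF bij] finite_fiber[OF config] by simp
  define N where "N = (\<lambda>k. (\<Prod>i<n. p $ i powr \<mu> i) ^ k / (\<Prod>i<n. Gamma (real k * \<mu> i + 1)))"
  have term_eq: "(\<Prod>i<n. p $ i ^ (f k z $ i)) / (\<Prod>i<n. fact (f k z $ i)) = N k * L.weight k z"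
    if k: "0 < k" and z: "z \<in> Z k" for k z
  proof -
    let ?g = "row_comb ?r b (\<lambda>l. of_int (z l) + real k * w l)"
    obtain y where y: "\<And>i. i < n \<Longrightarrow> row_comb d a y i = 1"
    proof -
      obtain y where y: "y \<in> carrier_vec d" "transpose_mat (map_mat real A) *\<^sub>v y = Matrix.vec n (\<lambda>_. 1)"
        using config A unfolding configuration_matrix_def by auto
      have "row_comb d a (\<lambda>j. y $ j) i = 1" if "i < n" for i
      proof -
        have "(transpose_mat (map_mat real A) *\<^sub>v y) $ i = 1" using y(2) that by simp
        then show ?thesis using y(1) A that by (simp add: row_comb_def scalar_prod_def lessThan_atLeast0)
      qed
      then show ?thesis by (rule that)
    qed
    \<comment> \<open>The all-ones vector is a combination of the rows of \<open>A\<close>, so the kernel vector \<open>?g\<close> has coordinate sum \<open>0\<close>.\<close>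
    have "(\<Sum>i<n. ?g i) = (\<Sum>i<n. row_comb d a y i * ?g i)" using y by simp
    then have g1: "(\<Sum>i<n. ?g i) = 0" by (simp add: row_combs_orthogonal)
    have "(\<Sum>i<n. (ln (\<mu> i) - ln (p $ i)) * ?g i) = 0"
      using mon by (simp add: sum_mult_row_comb right_diff_distrib sum_subtractf)
    then have "(\<Sum>i<n. ?g i * ln (real k * \<mu> i)) = (\<Sum>i<n. ?g i * ln (p $ i)) + ln (real k) * (\<Sum>i<n. ?g i)"
    proof -
      have "(\<Sum>i<n. ?g i * ln (real k * \<mu> i)) =
        (\<Sum>i<n. (ln (\<mu> i) - ln (p $ i)) * ?g i + (?g i * ln (p $ i) + ln (real k) * ?g i))"
        using k nz by (intro sum.cong) (auto simp: ln_mult algebra_simps)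
      then show ?thesis
        using \<open>(\<Sum>i<n. (ln (\<mu> i) - ln (p $ i)) * ?g i) = 0\<close>
        by (simp add: sum.distrib sum_distrib_left)
    qed
    then have "exp (\<Sum>i<n. ?g i * ln (real k * \<mu> i)) = exp (\<Sum>i<n. ?g i * ln (p $ i))"
      by (simp add: g1)
    then have key: "(\<Prod>i<n. (real k * \<mu> i) powr ?g i) = (\<Prod>i<n. p $ i powr ?g i)"
      using k nz by (simp add: exp_sum powr_def)
    have "(\<Prod>i<n. p $ i ^ (f k z $ i)) / (\<Prod>i<n. fact (f k z $ i)) =
      (\<Prod>i<n. p $ i ^ (f k z $ i) / fact (f k z $ i))" by (simp add: prod_dividef)
    also have "\<dots> = (\<Prod>i<n. ((p $ i powr \<mu> i) ^ k / Gamma (real k * \<mu> i + 1)) * (p $ i powr ?g i *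
        (Gamma (real k * \<mu> i + 1) * rGamma (L.point k z i + 1))))"
    proof (rule prod.cong[OF refl])
      fix i assume "i \<in> {..<n}"
      then have i: "i < n" by simp
      note G = Gamma_nz[OF i, of k]
      have "p $ i ^ (f k z $ i) = p $ i powr L.point k z i"
        unfolding f_nth[OF z i, symmetric] by (rule powr_realpow[OF p_pos[OF i], symmetric])
      also have "L.point k z i = \<mu> i * real k + ?g i" by (simp add: L.point_def mult.commute)
      also have "p $ i powr (\<mu> i * real k + ?g i) = (p $ i powr \<mu> i) ^ k * p $ i powr ?g i"
        using p_pos[OF i] by (simp add: powr_add powr_power mult.commute)
      finally have 1: "p $ i ^ (f k z $ i) = (p $ i powr \<mu> i) ^ k * p $ i powr ?g i" .
      have "fact (f k z $ i) = Gamma (L.point k z i + 1)"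
        unfolding f_nth[OF z i, symmetric] by (simp add: Gamma_fact add.commute)
      then have 2: "1 / fact (f k z $ i) = rGamma (L.point k z i + 1)"
        by (simp add: rGamma_inverse_Gamma divide_inverse)
      show "p $ i ^ (f k z $ i) / fact (f k z $ i) = ((p $ i powr \<mu> i) ^ k / Gamma (real k * \<mu> i + 1)) * (p $ i powr ?g i *
        (Gamma (real k * \<mu> i + 1) * rGamma (L.point k z i + 1)))"
        unfolding 1 2[symmetric] using G by simp
    qed
    also have "\<dots> = N k * ((\<Prod>i<n. p $ i powr ?g i) * (\<Prod>i<n. Gamma (real k * \<mu> i + 1) * rGamma (L.point k z i + 1)))"
      by (simp only: N_def prod.distrib prod_dividef prod_power_distrib)
    also have "\<dots> = N k * L.weight k z"
      unfolding key[symmetric] L.weight_def poisson_ratio_def point_diff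
      by (simp only: prod.distrib mult.assoc)
    finally show ?thesis .
  qed
  define D where "D = Determinant.det (Matrix.mat ?r ?r (\<lambda>(l, l'). gram_form n b \<mu> l l'))"
  have D: "0 < D" unfolding D_def by (rule gaussian_integral_quad_form(1)[OF L.pos_def_gram_form])
  have N: "N k \<noteq> 0" for k using nz Gamma_nz by (simp add: N_def)
  have "(\<lambda>k. (\<Sum>z\<in>Z k. L.weight k z) / sqrt (real k) ^ ?r) \<longlonglongrightarrow> sqrt ((2 * pi) ^ ?r / D)"
    unfolding Z_def D_def by (rule L.weight_sum_asymptotics[OF int fin[unfolded Z_def]])
  then have "(\<lambda>k. (\<Sum>z\<in>Z k. L.weight k z) / sqrt (real k) ^ ?r / sqrt ((2 * pi) ^ ?r / D))
      \<longlonglongrightarrow> sqrt ((2 * pi) ^ ?r / D) / sqrt ((2 * pi) ^ ?r / D)"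
    using D by (intro tendsto_divide tendsto_const) auto
  moreover have "sqrt ((2 * pi) ^ ?r / D) / sqrt ((2 * pi) ^ ?r / D) = 1" using D by simp
  ultimately have lim: "(\<lambda>k. (\<Sum>z\<in>Z k. L.weight k z) / sqrt (real k) ^ ?r / sqrt ((2 * pi) ^ ?r / D)) \<longlonglongrightarrow> 1"
    by simp
  have "(\<lambda>k. hypergeometric_poly A (k \<cdot>\<^sub>v \<beta>) p / (N k * ((2 * pi * real k) powr (real ?r / 2) / sqrt D))) \<longlonglongrightarrow> 1"
  proof (rule Lim_transform_eventually[OF lim])
    show "eventually (\<lambda>k. (\<Sum>z\<in>Z k. L.weight k z) / sqrt (real k) ^ ?r / sqrt ((2 * pi) ^ ?r / D) =
      hypergeometric_poly A (k \<cdot>\<^sub>v \<beta>) p / (N k * ((2 * pi * real k) powr (real ?r / 2) / sqrt D))) sequentially"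
      using eventually_gt_at_top[of 0]
    proof eventually_elim
      case (elim k)
      have "hypergeometric_poly A (k \<cdot>\<^sub>v \<beta>) p =
          (\<Sum>v\<in>fiber A (k \<cdot>\<^sub>v \<beta>). (\<Prod>i<n. p $ i ^ (v $ i)) / (\<Prod>i<n. fact (v $ i)))"
        using A by (simp add: hypergeometric_poly_def)
      also have "\<dots> = (\<Sum>z\<in>Z k. (\<Prod>i<n. p $ i ^ (f k z $ i)) / (\<Prod>i<n. fact (f k z $ i)))"
        by (rule sum.reindex_bij_betw[OF bij, symmetric])
      also have "\<dots> = N k * (\<Sum>z\<in>Z k. L.weight k z)"
        unfolding sum_distrib_left by (intro sum.cong refl term_eq elim)
      finally have 1: "hypergeometric_poly A (k \<cdot>\<^sub>v \<beta>) p = N k * (\<Sum>z\<in>Z k. L.weight k z)" .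
      have "(2 * pi * real k) powr (real ?r / 2) = sqrt ((2 * pi * real k) ^ ?r)"
        using elim by (subst powr_half_sqrt_powr) (auto simp: powr_realpow simp del: power_mult_distrib)
      also have "\<dots> = sqrt ((2 * pi) ^ ?r) * sqrt (real k) ^ ?r"
        by (simp only: power_mult_distrib[of "2 * pi"] real_sqrt_mult[of "(2 * pi) ^ ?r"] real_sqrt_power)
      finally have 2: "(2 * pi * real k) powr (real ?r / 2) = sqrt ((2 * pi) ^ ?r) * sqrt (real k) ^ ?r" .
      show ?case unfolding 1 2 using N[of k] D elim
        by (simp only: real_sqrt_divide) (simp add: field_simps)
    qed
  qed
  then show ?thesis
    by (simp only: gram_matrix_eq[OF mc] N_def D_def \<mu>_def)
qed

end

theorem theorem6:
  fixes d n :: nat and A :: "nat mat" and B :: "int mat"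
    and \<beta> :: "nat Matrix.vec" and p :: "real Matrix.vec"
  assumes A: "A \<in> carrier_mat d n"
    and rank: "vec_space.rank d (map_mat real A) = d"
    and config: "configuration_matrix A"
    and gale: "gale_transform A B"
    and \<beta>_monoid: "\<beta> \<in> monoid_span A"
    and \<beta>_interior: "map_vec real \<beta> \<in> vec_topology d interior_of (cone_span A)"
    and p: "p \<in> pos_vec n"
  shows "(\<exists>!m. m \<in> pos_vec n \<and> map_mat real A *\<^sub>v m = map_vec real \<beta> \<and>
             (\<forall>i < n - d. int_monomial m (Matrix.row B i) = int_monomial p (Matrix.row B i))) \<and>
         (\<forall>m. m \<in> pos_vec n \<and> map_mat real A *\<^sub>v m = map_vec real \<beta> \<and>
             (\<forall>i < n - d. int_monomial m (Matrix.row B i) = int_monomial p (Matrix.row B i)) \<longrightarrow>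
           (\<lambda>k::nat. hypergeometric_poly A (k \<cdot>\<^sub>v \<beta>) p /
              ((\<Prod>i<n. p $ i powr (m $ i)) ^ k / (\<Prod>i<n. Gamma (real k * m $ i + 1)) *
               ((2 * pi * real k) powr (real (n - d) / 2) /
                sqrt (Determinant.det (map_mat real_of_int B * mat_diag n (\<lambda>i. inverse (m $ i)) *
                           transpose_mat (map_mat real_of_int B))))))
           \<longlonglongrightarrow> 1)"
proof -
  interpret hypergeometric_setup d n A B \<beta> p
    by unfold_locales (fact assms)+
  show ?thesis
    using solution_exists_unique solution_asymptotics unfolding solution_def by blast
qed

end
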